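(* Let $k$ be a field and let $\mathcal{C}$ be a finite deterministic cancellative category. Then for every $m\geq 0$ one has $\mathcal{X}^{m+1}\circ\delta^m=(-1)^{m+1}\,\partial^m\circ\mathcal{X}^m$ as maps $C^m(kNF^{\mathrm{ad}}(\mathcal{C}),k)\to C^{m+1}(k\mathcal{C})$.
   Context: A category is finite if it has finitely many objects and all its sets of morphisms are finite. For a morphism $a$, $s(a)$ and $t(a)$ are its source and target. The category algebra $k\mathcal{C}$ is the $k$-vector space with basis $\mathrm{Mor}(\mathcal{C})$ and product $ab=a\circ b$ if $s(a)=t(b)$, and $ab=0$ otherwise. $\mathcal{C}$ is left deterministic if for all $g\in\mathrm{Hom}_{\mathcal{C}}(x_1,x_2)$ and $b\in\mathrm{End}_{\mathcal{C}}(x_2)$ there is $a\in\mathrm{End}_{\mathcal{C}}(x_1)$ with $g\circ a=b\circ g$; right deterministic if for all $g\in\mathrm{Hom}_{\mathcal{C}}(x_1,x_2)$ and $a\in\mathrm{End}_{\mathcal{C}}(x_1)$ there is $b\in\mathrm{End}_{\mathcal{C}}(x_2)$ with $g\circ a=b\circ g$; deterministic if both. Cancellative means composition is both left and right cancellable. Hochschild complex: $C^0(k\mathcal{C})=k\mathcal{C}$, $C^m(k\mathcal{C})=\mathrm{Hom}_k((k\mathcal{C})^{\otimes m},k\mathcal{C})$ for $m\ge1$; $\partial^0(f)(a)=af-fa$ and for $m\ge 1$ $$\partial^m(f)(a_1\otimes\cdots\otimes a_{m+1})=a_1f(a_2\otimes\cdots\otimes a_{m+1})+\sum_{j=1}^m(-1)^jf(a_1\otimes\cdots\otimes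 a_ja_{j+1}\otimes\cdots\otimes a_{m+1})+(-1)^{m+1}f(a_1\otimes\cdots\otimes a_m)a_{m+1}.$$ The adjoint category $F^{\mathrm{ad}}(\mathcal{C})$ has as objects all endomorphisms in $\mathcal{C}$; a morphism from $a\in\mathrm{End}_{\mathcal{C}}(x_1)$ to $b\in\mathrm{End}_{\mathcal{C}}(x_2)$ is a $g\in\mathrm{Hom}_{\mathcal{C}}(x_1,x_2)$ with $g\circ a=b\circ g$. Simplicial complex of $\mathcal{D}=F^{\mathrm{ad}}(\mathcal{C})$: $N\mathcal{D}_m$ is the set of chains $\sigma=(a_0\xrightarrow{g_0}a_1\to\cdots\xrightarrow{g_{m-1}}a_m)$ of $m$ composable morphisms in $\mathcal{D}$ ($N\mathcal{D}_0=\mathrm{Ob}(\mathcal{D})$), $C^m(kN\mathcal{D},k)=\mathrm{Hom}_k(kN\mathcal{D}_m,k)$, and $\delta^m(f)=\sum_{i=0}^{m+1}(-1)^i f\circ d_i^m$, where $d_i^m:N\mathcal{D}_{m+1}\to N\mathcal{D}_m$ drops $a_0$ (and $g_0$) if $i=0$, drops $a_{m+1}$ (and $g_m$) if $i=m+1$, and composes at $a_i$ (replacing $g_{i-1},g_i$ by $g_i\circ g_{i-1}$) if $1\le i\le m$. The maps $\mathcal{X}^m$: since $\mathcal{C}$ is right deterministic and right cancellative, for composable morphisms $g_{m-1},\dots,g_0$ of $\mathcal{C}$ and $a_0\in\mathrm{End}_{\mathcal{C}}(s(g_0))$ there are unique endomorphisms $a_1,\dots,a_m$ such that $\sigma(g_{m-1},\dots,g_0;a_0):=(a_0\xrightarrow{g_0}a_1\to\cdots\xrightarrow{g_{m-1}}a_m)$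 is a chain in $F^{\mathrm{ad}}(\mathcal{C})$. For $T\in C^m(kNF^{\mathrm{ad}}(\mathcal{C}),k)$, $m\ge1$, and $g_0,\dots,g_{m-1}\in\mathrm{Mor}(\mathcal{C})$, set $$\mathcal{X}^m(T)(g_{m-1}\otimes\cdots\otimes g_0)=\sum_{a_0\in\mathrm{End}_{\mathcal{C}}(s(g_0))}T(\sigma(g_{m-1},\dots,g_0;a_0))\;g_{m-1}\cdots g_1g_0a_0$$ if $g_{m-1},\dots,g_0$ are composable, and $0$ otherwise, extended linearly. For $m=0$, $\mathcal{X}^0(T)=\sum_{a_0}T(a_0)a_0$, the sum over all endomorphisms $a_0$ of $\mathcal{C}$. *)

theory Defs
  imports "HOL-Library.Poly_Mapping" "HOL-Library.FuncSet"
begin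

section \<open>Small categories\<close>

record ('o, 'm) cat =
  Ob :: "'o set"
  Mor :: "'m set"
  src :: "'m \<Rightarrow> 'o"
  tgt :: "'m \<Rightarrow> 'o"
  ident :: "'o \<Rightarrow> 'm"
  cmp :: "'m \<Rightarrow> 'm \<Rightarrow> 'm"

definition Hom :: "('o, 'm) cat \<Rightarrow> 'o \<Rightarrow> 'o \<Rightarrow> 'm set"
  where "Hom C x y = {f \<in> Mor C. src C f = x \<and> tgt C f = y}"

abbreviation End :: "('o, 'm) cat \<Rightarrow> 'o \<Rightarrow> 'm set"
  where "End C x \<equiv> Hom C x x"

text \<open>\<^term>\<open>cmp C g f\<close> is "g after f", meaningful when \<^prop>\<open>src C g = tgt C f\<close>.\<close>

locale category =
  fixes C :: "('o, 'm) cat"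
  assumes src_in: "f \<in> Mor C \<Longrightarrow> src C f \<in> Ob C"
    and tgt_in: "f \<in> Mor C \<Longrightarrow> tgt C f \<in> Ob C"
    and ident_in: "x \<in> Ob C \<Longrightarrow> ident C x \<in> End C x"
    and cmp_in: "\<lbrakk>g \<in> Hom C y z; f \<in> Hom C x y\<rbrakk> \<Longrightarrow> cmp C g f \<in> Hom C x z"
    and cmp_ident_right: "f \<in> Hom C x y \<Longrightarrow> cmp C f (ident C x) = f"
    and cmp_ident_left: "f \<in> Hom C x y \<Longrightarrow> cmp C (ident C y) f = f"
    and cmp_assoc: "\<lbrakk>h \<in> Hom C z w; g \<in> Hom C y z; f \<in> Hom C x y\<rbrakk>
      \<Longrightarrow> cmp C (cmp C h g) f = cmp C h (cmp C g f)"

definition finite_category :: "('o, 'm) cat \<Rightarrow> bool"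
  where "finite_category C \<longleftrightarrow>
    category C \<and> finite (Ob C) \<and> (\<forall>x\<in>Ob C. \<forall>y\<in>Ob C. finite (Hom C x y))"

definition left_deterministic :: "('o, 'm) cat \<Rightarrow> bool"
  where "left_deterministic C \<longleftrightarrow>
    (\<forall>x1\<in>Ob C. \<forall>x2\<in>Ob C. \<forall>g\<in>Hom C x1 x2. \<forall>b\<in>End C x2.
      \<exists>a\<in>End C x1. cmp C g a = cmp C b g)"

definition right_deterministic :: "('o, 'm) cat \<Rightarrow> bool"
  where "right_deterministic C \<longleftrightarrow>
    (\<forall>x1\<in>Ob C. \<forall>x2\<in>Ob C. \<forall>g\<in>Hom C x1 x2. \<forall>a\<in>End C x1.
      \<exists>b\<in>End C x2. cmp C g a = cmp C b g)"

definition deterministic :: "('o, 'm) cat \<Rightarrow> bool"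
  where "deterministic C \<longleftrightarrow> left_deterministic C \<and> right_deterministic C"

definition left_cancellative :: "('o, 'm) cat \<Rightarrow> bool"
  where "left_cancellative C \<longleftrightarrow>
    (\<forall>x\<in>Ob C. \<forall>y\<in>Ob C. \<forall>z\<in>Ob C. \<forall>g\<in>Hom C y z. \<forall>f\<in>Hom C x y. \<forall>f'\<in>Hom C x y.
      cmp C g f = cmp C g f' \<longrightarrow> f = f')"

definition right_cancellative :: "('o, 'm) cat \<Rightarrow> bool"
  where "right_cancellative C \<longleftrightarrow>
    (\<forall>x\<in>Ob C. \<forall>y\<in>Ob C. \<forall>z\<in>Ob C. \<forall>f\<in>Hom C x y. \<forall>g\<in>Hom C y z. \<forall>g'\<in>Hom C y z.
      cmp C g f = cmp C g' f \<longrightarrow> g = g')"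

definition cancellative :: "('o, 'm) cat \<Rightarrow> bool"
  where "cancellative C \<longleftrightarrow> left_cancellative C \<and> right_cancellative C"


section \<open>The adjoint category\<close>

definition endos :: "('o, 'm) cat \<Rightarrow> 'm set"
  where "endos C = (\<Union>x\<in>Ob C. End C x)"

text \<open>
  A morphism of \<open>C\<close> may underlie several morphisms of the adjoint category, so that these are
  recorded as triples (source, underlying morphism, target).
\<close>

definition adjoint_category :: "('o, 'm) cat \<Rightarrow> ('m, 'm \<times> 'm \<times> 'm) cat"
  where "adjoint_category C =
    \<lparr> Ob = endos C,
      Mor = {(a, g, b). a \<in> endos C \<and> b \<in> endos C \<and> g \<in> Hom C (src C a) (src C b)
                        \<and> cmp C g a = cmp C b g},
      src = (\<lambda>(a, g, b). a),
      tgt = (\<lambda>(a, g, b). b),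
      ident = (\<lambda>a. (a, ident C (src C a), a)),
      cmp = (\<lambda>(b, h, c) (a, g, b'). (a, cmp C h g, c)) \<rparr>"


section \<open>Free vector spaces\<close>

definition smul :: "'k::field \<Rightarrow> ('a \<Rightarrow>\<^sub>0 'k) \<Rightarrow> ('a \<Rightarrow>\<^sub>0 'k)"
  where "smul c v = Poly_Mapping.map ((*) c) v"

definition free_space :: "'a set \<Rightarrow> ('a \<Rightarrow>\<^sub>0 'k::field) set"
  where "free_space S = {v. Poly_Mapping.keys v \<subseteq> S}"

definition free_map :: "('a \<Rightarrow> 'b) \<Rightarrow> ('a \<Rightarrow>\<^sub>0 'k::field) \<Rightarrow> ('b \<Rightarrow>\<^sub>0 'k)"
  where "free_map d v =
    (\<Sum>x\<in>Poly_Mapping.keys v. Poly_Mapping.single (d x) (Poly_Mapping.lookup v x))"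


section \<open>Simplicial cochains of the nerve\<close>

text \<open>
  A chain \<open>a\<^sub>0 \<rightarrow> \<dots> \<rightarrow> a\<^sub>m\<close> is the pair of its list of \<open>m + 1\<close> objects and its list of
  \<open>m\<close> arrows \<open>[g\<^sub>0, \<dots>, g\<^sub>m\<^sub>-\<^sub>1]\<close>; for \<open>m = 0\<close> it is just an object.
\<close>

type_synonym ('o, 'm) chain = "'o list \<times> 'm list"

definition nerve :: "('o, 'm) cat \<Rightarrow> nat \<Rightarrow> ('o, 'm) chain set"
  where "nerve D m = {(as, gs). length as = m + 1 \<and> length gs = m \<and> set as \<subseteq> Ob D \<and>
    (\<forall>i<m. gs ! i \<in> Hom D (as ! i) (as ! (i + 1)))}"

text \<open>\<^term>\<open>face D m i\<close> is \<open>d\<^sub>i\<^sup>m\<close>, from chains of length \<open>m + 1\<close> to chains of length \<open>m\<close>.\<close>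

definition face :: "('o, 'm) cat \<Rightarrow> nat \<Rightarrow> nat \<Rightarrow> ('o, 'm) chain \<Rightarrow> ('o, 'm) chain"
  where "face D m i = (\<lambda>(as, gs).
    (take i as @ drop (i + 1) as,
     if i = 0 then tl gs
     else if i = m + 1 then butlast gs
     else take (i - 1) gs @ [cmp D (gs ! i) (gs ! (i - 1))] @ drop (i + 1) gs))"

definition simplicial_cochains ::
    "('o, 'm) cat \<Rightarrow> nat \<Rightarrow> ((('o, 'm) chain \<Rightarrow>\<^sub>0 'k::field) \<Rightarrow> 'k) set"
  where "simplicial_cochains D m = {f \<in> free_space (nerve D m) \<rightarrow>\<^sub>E UNIV.
    (\<forall>u\<in>free_space (nerve D m). \<forall>v\<in>free_space (nerve D m). f (u + v) = f u + f v) \<and>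
    (\<forall>c. \<forall>v\<in>free_space (nerve D m). f (smul c v) = c * f v)}"

definition simplicial_coboundary ::
    "('o, 'm) cat \<Rightarrow> nat \<Rightarrow> ((('o, 'm) chain \<Rightarrow>\<^sub>0 'k::field) \<Rightarrow> 'k)
      \<Rightarrow> (('o, 'm) chain \<Rightarrow>\<^sub>0 'k) \<Rightarrow> 'k"
  where "simplicial_coboundary D m f =
    (\<lambda>v\<in>free_space (nerve D (m + 1)). \<Sum>i=0..m + 1. (- 1) ^ i * f (free_map (face D m i) v))"


section \<open>The category algebra and its Hochschild cochains\<close>

definition category_algebra :: "('o, 'm) cat \<Rightarrow> ('m \<Rightarrow>\<^sub>0 'k::field) set"
  where "category_algebra C = free_space (Mor C)"

definition alg_mult ::
    "('o, 'm) cat \<Rightarrow> ('m \<Rightarrow>\<^sub>0 'k::field) \<Rightarrow> ('m \<Rightarrow>\<^sub>0 'k) \<Rightarrow> ('m \<Rightarrow>\<^sub>0 'k)"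
  where "alg_mult C u v =
    (\<Sum>a\<in>Poly_Mapping.keys u. \<Sum>b\<in>Poly_Mapping.keys v.
      if src C a = tgt C b
      then Poly_Mapping.single (cmp C a b) (Poly_Mapping.lookup u a * Poly_Mapping.lookup v b)
      else 0)"

text \<open>
  A linear map out of the \<open>m\<close>-th tensor power of the category algebra \<open>A\<close> is given by its
  values on pure tensors \<open>a\<^sub>1 \<otimes> \<dots> \<otimes> a\<^sub>m\<close>, i.e. by an \<open>m\<close>-multilinear map on
  lists \<open>[a\<^sub>1, \<dots>, a\<^sub>m]\<close>. For \<open>m = 0\<close> this is a function on the singleton \<open>{[]}\<close>,
  that is, an element of \<open>A\<close>.
\<close>

definition alg_tuples :: "('o, 'm) cat \<Rightarrow> nat \<Rightarrow> ('m \<Rightarrow>\<^sub>0 'k::field) list set"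
  where "alg_tuples C m = {vs. length vs = m \<and> set vs \<subseteq> category_algebra C}"

definition hochschild_cochains ::
    "('o, 'm) cat \<Rightarrow> nat \<Rightarrow> (('m \<Rightarrow>\<^sub>0 'k::field) list \<Rightarrow> ('m \<Rightarrow>\<^sub>0 'k)) set"
  where "hochschild_cochains C m = {f \<in> alg_tuples C m \<rightarrow>\<^sub>E category_algebra C.
    (\<forall>vs\<in>alg_tuples C m. \<forall>i<m. \<forall>u\<in>category_algebra C. \<forall>v\<in>category_algebra C. \<forall>c.
      f (vs[i := u + v]) = f (vs[i := u]) + f (vs[i := v]) \<and>
      f (vs[i := smul c u]) = smul c (f (vs[i := u])))}"

definition hochschild_smul ::
    "('o, 'm) cat \<Rightarrow> nat \<Rightarrow> 'k::field \<Rightarrow> (('m \<Rightarrow>\<^sub>0 'k) list \<Rightarrow> ('m \<Rightarrow>\<^sub>0 'k))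
      \<Rightarrow> ('m \<Rightarrow>\<^sub>0 'k) list \<Rightarrow> ('m \<Rightarrow>\<^sub>0 'k)"
  where "hochschild_smul C m c f = (\<lambda>vs\<in>alg_tuples C m. smul c (f vs))"

text \<open>
  The argument \<open>a\<^sub>j\<close> is \<open>vs ! (j - 1)\<close>. For \<open>m = 0\<close> the middle sum is empty and the
  formula reads \<open>a f - f a\<close>.
\<close>

definition hochschild_coboundary ::
    "('o, 'm) cat \<Rightarrow> nat \<Rightarrow> (('m \<Rightarrow>\<^sub>0 'k::field) list \<Rightarrow> ('m \<Rightarrow>\<^sub>0 'k))
      \<Rightarrow> ('m \<Rightarrow>\<^sub>0 'k) list \<Rightarrow> ('m \<Rightarrow>\<^sub>0 'k)"
  where "hochschild_coboundary C m f = (\<lambda>vs\<in>alg_tuples C (m + 1).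
    alg_mult C (hd vs) (f (tl vs))
    + (\<Sum>j=1..m. smul ((- 1) ^ j)
        (f (take (j - 1) vs @ [alg_mult C (vs ! (j - 1)) (vs ! j)] @ drop (j + 1) vs)))
    + smul ((- 1) ^ (m + 1)) (alg_mult C (f (butlast vs)) (last vs)))"


section \<open>The comparison maps\<close>

text \<open>
  Words of morphisms are written in the order of composition, \<open>ws = [g\<^sub>m\<^sub>-\<^sub>1, \<dots>, g\<^sub>0]\<close>,
  whereas the arrows of a chain are listed from \<open>g\<^sub>0\<close> on; hence the reversal in \<open>sigma\<close>.
\<close>

definition composable :: "('o, 'm) cat \<Rightarrow> 'm list \<Rightarrow> bool"
  where "composable C ws \<longleftrightarrow> (\<forall>i. i + 1 < length ws \<longrightarrow> src C (ws ! i) = tgt C (ws ! (i + 1)))"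

definition sigma :: "('o, 'm) cat \<Rightarrow> 'm list \<Rightarrow> 'm \<Rightarrow> ('m, 'm \<times> 'm \<times> 'm) chain"
  where "sigma C ws a0 = (THE \<tau>. \<tau> \<in> nerve (adjoint_category C) (length ws) \<and>
    hd (fst \<tau>) = a0 \<and> map (\<lambda>(a, g, b). g) (snd \<tau>) = rev ws)"

definition chi_basis ::
    "('o, 'm) cat \<Rightarrow> ((('m, 'm \<times> 'm \<times> 'm) chain \<Rightarrow>\<^sub>0 'k::field) \<Rightarrow> 'k)
      \<Rightarrow> 'm list \<Rightarrow> ('m \<Rightarrow>\<^sub>0 'k)"
  where "chi_basis C T ws =
    (if composable C ws
     then \<Sum>a0\<in>(if ws = [] then endos C else End C (src C (last ws))).
            smul (T (Poly_Mapping.single (sigma C ws a0) 1))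
              (Poly_Mapping.single (foldr (cmp C) ws a0) 1)
     else 0)"

text \<open>The multilinear extension of \<^const>\<open>chi_basis\<close> from the basis of tuples of morphisms.\<close>

definition chi ::
    "('o, 'm) cat \<Rightarrow> nat \<Rightarrow> ((('m, 'm \<times> 'm \<times> 'm) chain \<Rightarrow>\<^sub>0 'k::field) \<Rightarrow> 'k)
      \<Rightarrow> ('m \<Rightarrow>\<^sub>0 'k) list \<Rightarrow> ('m \<Rightarrow>\<^sub>0 'k)"
  where "chi C m T = (\<lambda>vs\<in>alg_tuples C m.
    \<Sum>ws | length ws = m \<and> set ws \<subseteq> Mor C.
      smul (\<Prod>i<m. Poly_Mapping.lookup (vs ! i) (ws ! i)) (chi_basis C T ws))"


section \<open>Well-definedness\<close>

lemma lookup_smul: "Poly_Mapping.lookup (smul c v) x = c * Poly_Mapping.lookup v x"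
  by (simp add: smul_def map.rep_eq when_def)

lemma smul_add: "smul c (u + v) = smul c u + smul c v"
  by (rule poly_mapping_eqI) (simp add: lookup_smul lookup_add distrib_left)

lemma add_smul: "smul (c + d) v = smul c v + smul d v"
  by (rule poly_mapping_eqI) (simp add: lookup_smul lookup_add distrib_right)

lemma smul_smul: "smul c (smul d v) = smul (c * d) v"
  by (rule poly_mapping_eqI) (simp add: lookup_smul)

lemma smul_zero: "smul c 0 = 0"
  by (rule poly_mapping_eqI) (simp add: lookup_smul)

lemma smul_sum: "smul c (sum f A) = (\<Sum>x\<in>A. smul c (f x))"
  by (induction A rule: infinite_finite_induct) (simp_all add: smul_zero smul_add)

lemma free_space_iff: "v \<in> free_space S \<longleftrightarrow> (\<forall>x. x \<notin> S \<longrightarrow> Poly_Mapping.lookup v x = 0)"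
  by (auto simp: free_space_def in_keys_iff)

lemma free_space_add: "\<lbrakk>u \<in> free_space S; v \<in> free_space S\<rbrakk> \<Longrightarrow> u + v \<in> free_space S"
  by (simp add: free_space_iff lookup_add)

lemma free_space_smul: "v \<in> free_space S \<Longrightarrow> smul c v \<in> free_space S"
  by (simp add: free_space_iff lookup_smul)

lemma free_space_sum: "(\<And>x. x \<in> A \<Longrightarrow> f x \<in> free_space S) \<Longrightarrow> sum f A \<in> free_space S"
  by (auto simp: free_space_iff lookup_sum intro!: sum.neutral)

lemma free_space_single: "x \<in> S \<Longrightarrow> Poly_Mapping.single x c \<in> free_space S"
  by (auto simp: free_space_iff lookup_single when_def)

lemma free_map_superset:
  assumes "finite B" "Poly_Mapping.keys v \<subseteq> B"
  shows "free_map d v = (\<Sum>x\<in>B. Poly_Mapping.single (d x) (Poly_Mapping.lookup v x))"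
  unfolding free_map_def using assms
  by (intro sum.mono_neutral_left) (auto simp: in_keys_iff)

lemma free_map_add: "free_map d (u + v) = free_map d u + free_map d v"
  using keys_add[of u v]
  by (simp add: free_map_superset[where B = "Poly_Mapping.keys u \<union> Poly_Mapping.keys v"]
      lookup_add single_add sum.distrib)

lemma smul_single: "smul c (Poly_Mapping.single x d) = Poly_Mapping.single x (c * d)"
  by (rule poly_mapping_eqI) (simp add: lookup_smul lookup_single when_def)

lemma free_map_smul: "free_map d (smul c v) = smul c (free_map d v)"
proof -
  have "Poly_Mapping.keys (smul c v) \<subseteq> Poly_Mapping.keys v"
    by (auto simp: in_keys_iff lookup_smul)
  then show ?thesis
    by (simp add: free_map_superset[where B = "Poly_Mapping.keys v"]
        lookup_smul smul_sum smul_single)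
qed

lemma free_map_in:
  assumes "v \<in> free_space S" "\<And>x. x \<in> S \<Longrightarrow> d x \<in> S'"
  shows "free_map d v \<in> free_space S'"
  unfolding free_map_def using assms
  by (intro free_space_sum free_space_single) (auto simp: free_space_def)

lemma endosD: "a \<in> endos C \<Longrightarrow> a \<in> End C (src C a) \<and> tgt C a = src C a \<and> a \<in> Mor C"
  by (auto simp: endos_def Hom_def)

lemma (in category) endosI: "a \<in> End C x \<Longrightarrow> a \<in> endos C"
  using src_in by (auto simp: endos_def Hom_def)

lemma (in category) category_adjoint_category: "category (adjoint_category C)"
proof -
  have [simp]: "Ob (adjoint_category C) = endos C" "src (adjoint_category C) = (\<lambda>(a, g, b). a)"
    "tgt (adjoint_category C) = (\<lambda>(a, g, b). b)"
    "ident (adjoint_category C) = (\<lambda>a. (a, ident C (src C a), a))"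
    "cmp (adjoint_category C) = (\<lambda>(b, h, c) (a, g, b'). (a, cmp C h g, c))"
    "Mor (adjoint_category C) = {(a, g, b). a \<in> endos C \<and> b \<in> endos C \<and>
       g \<in> Hom C (src C a) (src C b) \<and> cmp C g a = cmp C b g}"
    by (simp_all add: adjoint_category_def)
  have H: "Hom (adjoint_category C) a b = {(a, g, b) | g. a \<in> endos C \<and> b \<in> endos C \<and>
       g \<in> Hom C (src C a) (src C b) \<and> cmp C g a = cmp C b g}" for a b
    by (auto simp: Hom_def)
  show ?thesis
  proof
    fix a assume a: "a \<in> Ob (adjoint_category C)"
    then show "ident (adjoint_category C) a \<in> End (adjoint_category C) a"
      using endosD[of a C] src_in[of a]
      by (auto simp: H ident_in cmp_ident_left cmp_ident_right)
  next
    fix p q a b c assume "p \<in> Hom (adjoint_category C) b c" "q \<in> Hom (adjoint_category C) a b"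
    then obtain h g where E: "p = (b, h, c)" "q = (a, g, b)" and
      h: "b \<in> endos C" "c \<in> endos C" "h \<in> Hom C (src C b) (src C c)" "cmp C h b = cmp C c h" and
      g: "a \<in> endos C" "g \<in> Hom C (src C a) (src C b)" "cmp C g a = cmp C b g"
      by (auto simp: H)
    have "cmp C (cmp C h g) a = cmp C c (cmp C h g)"
      using h g endosD[of a C] endosD[of b C] endosD[of c C] by (metis cmp_assoc)
    then show "cmp (adjoint_category C) p q \<in> Hom (adjoint_category C) a c"
      using E h g cmp_in by (auto simp: H)
  next
    fix f a b assume "f \<in> Hom (adjoint_category C) a b"
    then show "cmp (adjoint_category C) f (ident (adjoint_category C) a) = f"
      and "cmp (adjoint_category C) (ident (adjoint_category C) b) f = f"
      using cmp_ident_left cmp_ident_right by (auto simp: H)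
  next
    fix p q r a b c d
    assume "p \<in> Hom (adjoint_category C) c d" "q \<in> Hom (adjoint_category C) b c"
      "r \<in> Hom (adjoint_category C) a b"
    then show "cmp (adjoint_category C) (cmp (adjoint_category C) p q) r
        = cmp (adjoint_category C) p (cmp (adjoint_category C) q r)"
      by (auto simp: H intro: cmp_assoc)
  qed auto
qed

lemma nerve_snoc:
  "(as, gs) \<in> nerve D (Suc m) \<longleftrightarrow> (\<exists>as' gs' a g. as = as' @ [a] \<and> gs = gs' @ [g] \<and>
     (as', gs') \<in> nerve D m \<and> a \<in> Ob D \<and> g \<in> Hom D (last as') a)"
proof safe
  assume *: "(as, gs) \<in> nerve D (Suc m)"
  then obtain as' a gs' g where E: "as = as' @ [a]" "gs = gs' @ [g]"
    by (cases as rule: rev_cases; cases gs rule: rev_cases) (auto simp: nerve_def)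
  from * E have l: "length as' = Suc m" "length gs' = m" by (auto simp: nerve_def)
  from * E have A: "\<forall>i<Suc m. (gs' @ [g]) ! i \<in> Hom D ((as' @ [a]) ! i) ((as' @ [a]) ! Suc i)"
    by (auto simp: nerve_def)
  have "gs' ! i \<in> Hom D (as' ! i) (as' ! Suc i)" if "i < m" for i
    using A[rule_format, of i] that l by (simp add: nth_append)
  moreover have "g \<in> Hom D (last as') a"
    using A[rule_format, of m] l by (cases as' rule: rev_cases) (simp_all add: nth_append)
  ultimately show "\<exists>as' gs' a g. as = as' @ [a] \<and> gs = gs' @ [g] \<and>
     (as', gs') \<in> nerve D m \<and> a \<in> Ob D \<and> g \<in> Hom D (last as') a"
    using E l * by (auto simp: nerve_def)
next
  fix as' gs' a g assume *: "(as', gs') \<in> nerve D m" "a \<in> Ob D" "g \<in> Hom D (last as') a"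
  then have "last as' = as' ! m" by (cases "as' = []") (auto simp: nerve_def last_conv_nth)
  with * show "(as' @ [a], gs' @ [g]) \<in> nerve D (Suc m)"
    by (auto simp: nerve_def nth_append less_Suc_eq)
qed

text \<open>The definite description in \<^const>\<open>sigma\<close> is justified for exactly the arguments at
  which \<^const>\<open>chi_basis\<close> uses it.\<close>

lemma (in category) sigma_ex1:
  assumes "right_deterministic C" "right_cancellative C"
    and "composable C ws" "set ws \<subseteq> Mor C"
    and "a0 \<in> (if ws = [] then endos C else End C (src C (last ws)))"
  shows "(\<exists>!\<tau>. \<tau> \<in> nerve (adjoint_category C) (length ws) \<and>
    hd (fst \<tau>) = a0 \<and> map (\<lambda>(a, g, b). g) (snd \<tau>) = rev ws)"
proof -
  let ?P = "\<lambda>ws \<tau>. \<tau> \<in> nerve (adjoint_category C) (length ws) \<and>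
    hd (fst \<tau>) = a0 \<and> map (\<lambda>(a, g, b). g) (snd \<tau>) = rev ws"
  have "(\<exists>!\<tau>. ?P ws \<tau>) \<and> (\<forall>\<tau>. ?P ws \<tau> \<longrightarrow> last (fst \<tau>) \<in> endos C \<and>
     (ws \<noteq> [] \<longrightarrow> src C (last (fst \<tau>)) = tgt C (hd ws)))"
    using assms(3-)
  proof (induction ws)
    case Nil
    then have "?P [] \<tau> \<longleftrightarrow> \<tau> = ([a0], [])" for \<tau>
      by (cases \<tau>) (auto simp: nerve_def adjoint_category_def length_Suc_conv)
    with Nil show ?case by auto
  next
    case (Cons g ws)
    have g: "g \<in> Hom C (src C g) (tgt C g)" using Cons.prems by (auto simp: Hom_def)
    have co: "composable C ws" using Cons.prems(1) unfolding composable_def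
      by (metis Suc_eq_plus1 Suc_less_eq length_Cons nth_Cons_Suc)
    have ne: "src C g = tgt C (hd ws)" if "ws \<noteq> []"
      using Cons.prems(1) that unfolding composable_def
      by (auto simp: hd_conv_nth dest!: spec[of _ 0])
    have a0': "a0 \<in> (if ws = [] then endos C else End C (src C (last ws)))"
      using Cons.prems(3) by (auto dest: endosI split: if_splits)
    have "set ws \<subseteq> Mor C" using Cons.prems(2) by simp
    note IH = Cons.IH[OF co this a0']
    then obtain \<tau> where "?P ws \<tau>" and U: "\<And>\<tau>'. ?P ws \<tau>' \<Longrightarrow> \<tau>' = \<tau>"
      by (elim conjE ex1E) blast
    obtain as gs where \<tau>: "\<tau> = (as, gs)" by (cases \<tau>)
    with \<open>?P ws \<tau>\<close> have P: "?P ws (as, gs)" by blast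
    from IH P have L: "last as \<in> endos C" "ws \<noteq> [] \<Longrightarrow> src C (last as) = tgt C (hd ws)"
      by (metis fst_conv)+
    have src_last: "src C (last as) = src C g"
    proof (cases "ws = []")
      case True
      then have "as = [a0]" using P by (auto simp: nerve_def length_Suc_conv)
      then show ?thesis using True Cons.prems(3) by (auto simp: Hom_def)
    qed (use ne L in auto)
    then have lE: "last as \<in> End C (src C g)" using endosD[OF L(1)] by simp
    have gO: "src C g \<in> Ob C" "tgt C g \<in> Ob C" using Cons.prems(2) src_in tgt_in by auto
    obtain b where b: "b \<in> End C (tgt C g)" "cmp C g (last as) = cmp C b g"
      using assms(1) g gO lE unfolding right_deterministic_def by blast
    have bu: "b' = b" if "b' \<in> End C (tgt C g)" "cmp C g (last as) = cmp C b' g" for b'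
      using assms(2) g gO b that unfolding right_cancellative_def by metis
    have bE: "b \<in> endos C" "src C b = tgt C g" using b endosI by (auto simp: Hom_def)
    let ?\<tau> = "(as @ [b], gs @ [(last as, g, b)])"
    have ah: "as \<noteq> []" using P by (auto simp: nerve_def)
    have P': "?P (g # ws) ?\<tau>"
      using P bE L b g src_last ah by (auto simp: nerve_snoc adjoint_category_def Hom_def)
    have "\<tau> = ?\<tau>" if t: "?P (g # ws) \<tau>" for \<tau>
    proof -
      obtain as'' gs'' where tt: "\<tau> = (as'', gs'')" by (cases \<tau>)
      with t have "(as'', gs'') \<in> nerve (adjoint_category C) (Suc (length ws))" by simp
      then obtain as' gs' a h where E: "as'' = as' @ [a]" "gs'' = gs' @ [h]"
        and n: "(as', gs') \<in> nerve (adjoint_category C) (length ws)"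
        and h: "a \<in> Ob (adjoint_category C)" "h \<in> Hom (adjoint_category C) (last as') a"
        unfolding nerve_snoc by blast
      have "as' \<noteq> []" using n by (auto simp: nerve_def)
      then have "?P ws (as', gs')" using n t tt E by auto
      then have e: "as' = as" "gs' = gs" using U[of "(as', gs')"] \<tau> by auto
      have "h = (last as, g, a)" "a \<in> endos C" "g \<in> Hom C (src C (last as)) (src C a)"
        "cmp C g (last as) = cmp C a g"
        using h t tt E e by (auto simp: adjoint_category_def Hom_def)
      moreover from this have "a = b" using bu endosD[of a C] by (auto simp: Hom_def)
      ultimately show ?thesis using tt E e by simp
    qed
    then have "\<exists>!\<tau>. ?P (g # ws) \<tau>" using P' by blast
    moreover have "last (fst \<tau>) \<in> endos C \<and> src C (last (fst \<tau>)) = tgt C (hd (g # ws))"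
      if "?P (g # ws) \<tau>" for \<tau>
      using \<open>\<And>\<tau>. ?P (g # ws) \<tau> \<Longrightarrow> \<tau> = ?\<tau>\<close>[OF that] bE by simp
    ultimately show ?case by blast
  qed
  then show ?thesis by blast
qed

lemma (in category) face_in:
  assumes D: "\<tau> \<in> nerve C (m + 1)" and i: "i \<le> m + 1"
  shows "face C m i \<tau> \<in> nerve C m"
proof -
  obtain as gs where t: "\<tau> = (as, gs)" by (cases \<tau>)
  from D t have l: "length as = m + 2" "length gs = m + 1" and s: "set as \<subseteq> Ob C"
    and H: "\<And>j. j < m + 1 \<Longrightarrow> gs ! j \<in> Hom C (as ! j) (as ! Suc j)" by (auto simp: nerve_def)
  have s': "set (take i as @ drop (Suc i) as) \<subseteq> Ob C"
    using s set_take_subset[of i as] set_drop_subset[of "Suc i" as] by auto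
  have n: "(take i as @ drop (Suc i) as) ! j = (if j < i then as ! j else as ! Suc j)" if "j \<le> m" for j
    using l i that by (auto simp: nth_append min_def)
  consider "i = 0" | "i = m + 1" | "0 < i" "i \<le> m" using i by linarith
  then show ?thesis
  proof cases
    case 1 then show ?thesis using t l s' n H by (auto simp: face_def nerve_def nth_tl drop_Suc)
  next
    case 2 then show ?thesis using t l s' n H
      by (auto simp: face_def nerve_def nth_butlast)
  next
    case 3
    then obtain p where p: "i = Suc p" by (cases i) auto
    have "(take p gs @ [cmp C (gs ! i) (gs ! p)] @ drop (Suc i) gs) ! j =
       (if j < p then gs ! j else if j = p then cmp C (gs ! i) (gs ! p) else gs ! Suc j)" if "j < m" for j
      using 3 p l that by (auto simp: nth_append min_def nth_Cons')
    moreover have "cmp C (gs ! i) (gs ! p) \<in> Hom C (as ! p) (as ! Suc i)"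
      using cmp_in H[of i] H[of p] 3 p by auto
    ultimately show ?thesis using 3 t l s' n H p
      by (auto simp: face_def nerve_def)
  qed
qed

lemma (in category) simplicial_coboundary_in:
  assumes "f \<in> simplicial_cochains C m"
  shows "simplicial_coboundary C m f \<in> simplicial_cochains C (m + 1)"
proof -
  let ?V = "free_space (nerve C m)" and ?W = "free_space (nerve C (m + 1))"
  have F: "free_map (face C m i) v \<in> ?V" if "v \<in> ?W" "i \<le> m + 1" for v i
    using that by (intro free_map_in[where S = "nerve C (m + 1)"] face_in) auto
  have L: "f (u + v) = f u + f v" "f (smul c v) = c * f v" if "u \<in> ?V" "v \<in> ?V" for u v c
    using assms that by (auto simp: simplicial_cochains_def)
  let ?d = "\<lambda>v. \<Sum>i=0..m + 1. (- 1) ^ i * f (free_map (face C m i) v)"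
  have "?d (u + v) = ?d u + ?d v" if "u \<in> ?W" "v \<in> ?W" for u v
    unfolding sum.distrib[symmetric] distrib_left[symmetric]
    using that F by (intro sum.cong refl) (simp only: free_map_add, subst L(1), auto)
  moreover have "?d (smul c v) = c * ?d v" if "v \<in> ?W" for v c
    unfolding sum_distrib_left
    using that F by (intro sum.cong refl) (simp only: free_map_smul, subst L(2), auto)
  ultimately show ?thesis
    unfolding simplicial_cochains_def simplicial_coboundary_def
    by (simp only: mem_Collect_eq restrict_apply' free_space_add free_space_smul
        restrict_PiE_iff) (simp add: free_space_add free_space_smul)
qed

lemma (in category) foldr_cmp_in:
  assumes "composable C ws" "set ws \<subseteq> Mor C" "a0 \<in> (if ws = [] then endos C else End C (src C (last ws)))"
  shows "foldr (cmp C) ws a0 \<in> Mor C \<and> (ws \<noteq> [] \<longrightarrow> tgt C (foldr (cmp C) ws a0) = tgt C (hd ws))"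
  using assms
proof (induction ws)
  case Nil then show ?case by (auto dest: endosD)
next
  case (Cons g ws)
  have co: "composable C ws" using Cons.prems(1) unfolding composable_def
    by (metis Suc_eq_plus1 Suc_less_eq length_Cons nth_Cons_Suc)
  have ne: "src C g = tgt C (hd ws)" if "ws \<noteq> []"
    using Cons.prems(1) that unfolding composable_def
    by (auto simp: hd_conv_nth dest!: spec[of _ 0])
  have a0': "a0 \<in> (if ws = [] then endos C else End C (src C (last ws)))"
    using Cons.prems(3) by (auto dest: endosI split: if_splits)
  let ?q = "foldr (cmp C) ws a0"
  have q: "?q \<in> Mor C" "tgt C ?q = src C g"
    using Cons.IH[OF co _ a0'] Cons.prems ne by (cases "ws = []"; auto simp: Hom_def)+
  then have "cmp C g ?q \<in> Hom C (src C ?q) (tgt C g)"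
    using Cons.prems by (intro cmp_in[of _ "src C g"]) (auto simp: Hom_def)
  then show ?case by (auto simp: Hom_def)
qed

lemma (in category) chi_basis_in:
  assumes "set ws \<subseteq> Mor C"
  shows "chi_basis C T ws \<in> category_algebra C"
  using foldr_cmp_in[OF _ assms] unfolding chi_basis_def category_algebra_def
  by (auto intro!: free_space_sum free_space_smul free_space_single simp: free_space_iff[of 0])

lemma (in category) chi_in: "chi C m T \<in> hochschild_cochains C m"
proof -
  let ?p = "\<lambda>vs ws. \<Prod>i<m. Poly_Mapping.lookup (vs ! i) (ws ! i)"
  have split: "?p (vs[i := u]) ws =
      Poly_Mapping.lookup u (ws ! i) * (\<Prod>j\<in>{..<m} - {i}. Poly_Mapping.lookup (vs ! j) (ws ! j))"
    if "i < m" "length vs = m" for vs i u ws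
    using that by (subst prod.remove[of _ i]) (auto intro!: prod.cong)
  have up: "vs[i := u] \<in> alg_tuples C m"
    if "vs \<in> alg_tuples C m" "u \<in> category_algebra C" for vs i u
    using that set_update_subset_insert[of vs i u] by (auto simp: alg_tuples_def)
  have cl: "u + v \<in> category_algebra C" "smul c u \<in> category_algebra C"
    if "u \<in> category_algebra C" "v \<in> category_algebra C" for u v c
    using that by (auto simp: category_algebra_def intro: free_space_add free_space_smul)
  have I: "chi C m T vs \<in> category_algebra C" if "vs \<in> alg_tuples C m" for vs
    using that chi_basis_in unfolding chi_def category_algebra_def
    by (auto intro!: free_space_sum free_space_smul)
  have A: "chi C m T (vs[i := u + v]) = chi C m T (vs[i := u]) + chi C m T (vs[i := v])"
    and S: "chi C m T (vs[i := smul c u]) = smul c (chi C m T (vs[i := u]))"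
    if *: "vs \<in> alg_tuples C m" "i < m" "u \<in> category_algebra C" "v \<in> category_algebra C"
    for vs i u v c
  proof -
    have l: "length vs = m" using * by (simp add: alg_tuples_def)
    show "chi C m T (vs[i := u + v]) = chi C m T (vs[i := u]) + chi C m T (vs[i := v])"
      using * unfolding chi_def
      by (simp only: up cl restrict_apply' split[OF \<open>i < m\<close> l] lookup_add distrib_right add_smul
          sum.distrib)
    show "chi C m T (vs[i := smul c u]) = smul c (chi C m T (vs[i := u]))"
      using * unfolding chi_def
      by (simp only: up cl restrict_apply' split[OF \<open>i < m\<close> l] lookup_smul smul_sum smul_smul
          mult.assoc)
  qed
  have E: "chi C m T \<in> extensional (alg_tuples C m)" by (simp add: chi_def)
  show ?thesis
    unfolding hochschild_cochains_def using I A S E by (auto simp: PiE_def)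
qed

end

theory Submission
  imports Defs
begin

text \<open>
  Both sides are multilinear, so it suffices to compare them on a word \<open>g\<^sub>m, \<dots>, g\<^sub>0\<close> of
  morphisms. If the word is not composable, every term vanishes. Otherwise, summing over \<open>a\<^sub>0\<close>,
  the face \<open>d\<^sub>i\<close> with \<open>1 \<le> i \<le> m\<close> matches the Hochschild term that multiplies \<open>g\<^sub>i\<close>
  and \<open>g\<^sub>i\<^sub>-\<^sub>1\<close>, and \<open>d\<^sub>m\<^sub>+\<^sub>1\<close> matches left multiplication by \<open>g\<^sub>m\<close>. The face \<open>d\<^sub>0\<close>
  replaces \<open>a\<^sub>0\<close> by the \<open>a\<^sub>1\<close> with \<open>g\<^sub>0 a\<^sub>0 = a\<^sub>1 g\<^sub>0\<close>; since \<open>a\<^sub>0 \<mapsto> a\<^sub>1\<close> is a bijection of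
  endomorphism sets by determinism and cancellation, reindexing turns this term into right
  multiplication by \<open>g\<^sub>0\<close>. Hochschild arguments are numbered from the other end of the word, which
  accounts for the sign.
\<close>

section \<open>Basis expansions in free vector spaces\<close>

abbreviation bas :: "'a \<Rightarrow> 'a \<Rightarrow>\<^sub>0 'k::field"
  where "bas x \<equiv> Poly_Mapping.single x 1"

lemma zero_smul: "smul 0 v = 0"
  by (rule poly_mapping_eqI) (simp add: lookup_smul)

lemma one_smul: "smul 1 v = v"
  by (rule poly_mapping_eqI) (simp add: lookup_smul)

lemma sum_smul: "smul (sum f A) v = (\<Sum>x\<in>A. smul (f x) v)"
  by (induction A rule: infinite_finite_induct) (simp_all add: zero_smul add_smul)

lemma keys_smul: "Poly_Mapping.keys (smul c v) \<subseteq> Poly_Mapping.keys v"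
  by (auto simp: in_keys_iff lookup_smul)

text \<open>Summing over all of the finite set \<open>S\<close> rather than over the support of
  \<open>v\<close> gives an index set independent of \<open>v\<close>, as in the recursion of
  \<open>mlext\<close>.\<close>

lemma free_space_basis_expansion:
  assumes "finite S" "v \<in> free_space S"
  shows "v = (\<Sum>x\<in>S. smul (Poly_Mapping.lookup v x) (bas x))"
proof (rule poly_mapping_eqI)
  fix y
  have "Poly_Mapping.lookup v y = (\<Sum>x\<in>S. if x = y then Poly_Mapping.lookup v x else 0)"
    using assms by (auto simp: free_space_iff)
  then show "Poly_Mapping.lookup v y
      = Poly_Mapping.lookup (\<Sum>x\<in>S. smul (Poly_Mapping.lookup v x) (bas x)) y"
    by (simp add: lookup_sum lookup_smul lookup_single when_def if_distrib cong: if_cong)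
qed

section \<open>Bilinearity of the product\<close>

text \<open>Supports change under addition and scaling, so the product is rewritten over larger
  index sets, where the added terms have coefficient zero. Bilinearity can then be checked
  termwise.\<close>

lemma alg_mult_superset:
  assumes "finite A" "finite B" "Poly_Mapping.keys u \<subseteq> A" "Poly_Mapping.keys v \<subseteq> B"
  shows "alg_mult C u v = (\<Sum>a\<in>A. \<Sum>b\<in>B.
      if src C a = tgt C b
      then Poly_Mapping.single (cmp C a b) (Poly_Mapping.lookup u a * Poly_Mapping.lookup v b)
      else 0)"
proof -
  have "alg_mult C u v = (\<Sum>a\<in>Poly_Mapping.keys u. \<Sum>b\<in>B.
      if src C a = tgt C b
      then Poly_Mapping.single (cmp C a b) (Poly_Mapping.lookup u a * Poly_Mapping.lookup v b)
      else 0)"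
    unfolding alg_mult_def using assms
    by (intro sum.cong refl sum.mono_neutral_left) (auto simp: in_keys_iff)
  also have "\<dots> = (\<Sum>a\<in>A. \<Sum>b\<in>B.
      if src C a = tgt C b
      then Poly_Mapping.single (cmp C a b) (Poly_Mapping.lookup u a * Poly_Mapping.lookup v b)
      else 0)"
    using assms by (intro sum.mono_neutral_left) (auto simp: in_keys_iff intro!: sum.neutral)
  finally show ?thesis .
qed

lemma alg_mult_add_left: "alg_mult C (u + u') v = alg_mult C u v + alg_mult C u' v"
proof -
  note S = alg_mult_superset[where A = "Poly_Mapping.keys u \<union> Poly_Mapping.keys u'"
      and B = "Poly_Mapping.keys v"]
  show ?thesis using keys_add[of u u']
    by (simp add: S sum.distrib[symmetric] lookup_add distrib_right single_add)
      (intro sum.cong refl, simp add: lookup_add distrib_right single_add)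
qed

lemma alg_mult_add_right: "alg_mult C u (v + v') = alg_mult C u v + alg_mult C u v'"
proof -
  note S = alg_mult_superset[where B = "Poly_Mapping.keys v \<union> Poly_Mapping.keys v'"
      and A = "Poly_Mapping.keys u"]
  show ?thesis using keys_add[of v v']
    by (simp add: S sum.distrib[symmetric] lookup_add distrib_left single_add)
      (intro sum.cong refl, simp add: lookup_add distrib_left single_add)
qed

lemma alg_mult_smul_left: "alg_mult C (smul c u) v = smul c (alg_mult C u v)"
  unfolding alg_mult_superset[OF finite_keys finite_keys keys_smul order_refl]
  by (simp add: alg_mult_def smul_sum lookup_smul if_distrib[of "smul c"] smul_single smul_zero
      mult.assoc cong: if_cong)

lemma alg_mult_smul_right: "alg_mult C u (smul c v) = smul c (alg_mult C u v)"
  unfolding alg_mult_superset[OF finite_keys finite_keys order_refl keys_smul]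
  by (simp add: alg_mult_def smul_sum lookup_smul if_distrib[of "smul c"] smul_single smul_zero
      mult.left_commute cong: if_cong)

lemma alg_mult_zero_left: "alg_mult C 0 v = 0"
  by (simp add: alg_mult_def)

lemma alg_mult_zero_right: "alg_mult C u 0 = 0"
  by (simp add: alg_mult_def)

lemma alg_mult_sum_left: "alg_mult C (sum f A) v = (\<Sum>x\<in>A. alg_mult C (f x) v)"
  by (induction A rule: infinite_finite_induct) (simp_all add: alg_mult_zero_left alg_mult_add_left)

lemma alg_mult_sum_right: "alg_mult C u (sum f A) = (\<Sum>x\<in>A. alg_mult C u (f x))"
  by (induction A rule: infinite_finite_induct) (simp_all add: alg_mult_zero_right alg_mult_add_right)

lemma alg_mult_bas:
  "alg_mult C (bas a) (bas b) = (if src C a = tgt C b then bas (cmp C a b) else 0)"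
  by (simp add: alg_mult_def)

lemma (in category) cmp_Mor: "\<lbrakk>g \<in> Mor C; f \<in> Mor C; src C g = tgt C f\<rbrakk>
    \<Longrightarrow> cmp C g f \<in> Mor C \<and> src C (cmp C g f) = src C f \<and> tgt C (cmp C g f) = tgt C g"
  using cmp_in[of g "src C g" "tgt C g" f "src C f"] by (auto simp: Hom_def)

lemma (in category) alg_mult_in:
  assumes "u \<in> category_algebra C" "v \<in> category_algebra C"
  shows "alg_mult C u v \<in> category_algebra C"
  using assms cmp_Mor unfolding alg_mult_def category_algebra_def
  by (intro free_space_sum) (auto simp: free_space_def[of "Mor C"] subset_iff
      intro: free_space_single split: if_splits)

section \<open>Multilinear extension from words\<close>

text \<open>The multilinear map with values \<open>h\<close> on basis words. The recursion peels off
  one tensor factor at a time, so that operations at the ends or in the middle of a tensor become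
  list manipulations.\<close>

primrec mlext :: "('o, 'm) cat \<Rightarrow> ('m list \<Rightarrow> 'b \<Rightarrow>\<^sub>0 'k::field) \<Rightarrow> ('m \<Rightarrow>\<^sub>0 'k) list \<Rightarrow> 'b \<Rightarrow>\<^sub>0 'k"
  where
    "mlext C h [] = h []"
  | "mlext C h (v # vs) =
      (\<Sum>w\<in>Mor C. smul (Poly_Mapping.lookup v w) (mlext C (\<lambda>ws. h (w # ws)) vs))"

lemma mlext_cong:
  assumes "\<And>ws. \<lbrakk>length ws = length vs; set ws \<subseteq> Mor C\<rbrakk> \<Longrightarrow> h ws = h' ws"
  shows "mlext C h vs = mlext C h' vs"
  using assms
proof (induction vs arbitrary: h h')
  case (Cons v vs)
  have "mlext C (\<lambda>ws. h (w # ws)) vs = mlext C (\<lambda>ws. h' (w # ws)) vs" if "w \<in> Mor C" for w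
    using that by (intro Cons.IH Cons.prems) auto
  then show ?case by simp
qed simp

lemma mlext_append:
  "mlext C h (us @ vs) = mlext C (\<lambda>us'. mlext C (\<lambda>vs'. h (us' @ vs')) vs) us"
  by (induction us arbitrary: h) simp_all

text \<open>\<open>mlext\<close> is built from finite sums and scalar multiples, and
  \<open>L\<close> commutes with both, so it can be moved inside to act on the values at
  words.\<close>

lemma linear_mlext:
  fixes h :: "'m list \<Rightarrow> 'b \<Rightarrow>\<^sub>0 'k::field"
  assumes "\<And>u v. L (u + v) = L u + L v" "\<And>c v. L (smul c v) = smul c (L v)"
  shows "L (mlext C h vs) = mlext C (\<lambda>ws. L (h ws)) vs"
proof (induction vs arbitrary: h)
  case (Cons v vs)
  \<comment> \<open>Homogeneity with scalar 0 covers the empty sum.\<close>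
  have "L 0 = 0" using assms(2)[of 0 0] by (simp add: zero_smul)
  then have "L (sum f A) = (\<Sum>x\<in>A. L (f x))" for f :: "'m \<Rightarrow> 'b \<Rightarrow>\<^sub>0 'k" and A
    by (induction A rule: infinite_finite_induct) (simp_all add: assms)
  then show ?case by (simp add: assms Cons)
qed simp

lemma mlext_add: "mlext C (\<lambda>ws. h ws + h' ws) vs = mlext C h vs + mlext C h' vs"
  by (induction vs arbitrary: h h') (simp_all add: smul_add sum.distrib)

lemma mlext_smul: "mlext C (\<lambda>ws. smul c (h ws)) vs = smul c (mlext C h vs)"
  by (rule linear_mlext[symmetric]) (simp_all add: smul_add smul_smul mult.commute)

lemma mlext_zero: "mlext C (\<lambda>ws. 0) vs = 0"
  by (induction vs) (simp_all add: smul_zero)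

lemma mlext_sum: "mlext C (\<lambda>ws. \<Sum>x\<in>A. h x ws) vs = (\<Sum>x\<in>A. mlext C (h x) vs)"
  by (induction A rule: infinite_finite_induct) (simp_all add: mlext_zero mlext_add)

text \<open>Expanding \<open>v\<close> in basis morphisms produces the sum that \<open>mlext\<close>
  performs for a new first argument.\<close>

lemma alg_mult_mlext:
  assumes "finite (Mor C)" "v \<in> category_algebra C"
  shows "alg_mult C v (mlext C h vs)
    = mlext C (\<lambda>ws. alg_mult C (bas (hd ws)) (h (tl ws))) (v # vs)"
proof -
  have "mlext C (\<lambda>ws. alg_mult C (bas w) (h ws)) vs = alg_mult C (bas w) (mlext C h vs)" for w
    by (rule linear_mlext[symmetric]) (simp_all add: alg_mult_add_right alg_mult_smul_right)
  then show ?thesis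
    using assms by (subst free_space_basis_expansion[of "Mor C" v])
      (simp_all add: category_algebra_def alg_mult_sum_left alg_mult_smul_left)
qed

text \<open>Here the expansion of \<open>v\<close> becomes the innermost sum, that of a new last
  argument.\<close>

lemma mlext_alg_mult:
  assumes "finite (Mor C)" "v \<in> category_algebra C"
  shows "alg_mult C (mlext C h vs) v
    = mlext C (\<lambda>ws. alg_mult C (h (butlast ws)) (bas (last ws))) (vs @ [v])"
proof -
  have "alg_mult C (mlext C h vs) v = mlext C (\<lambda>ws. alg_mult C (h ws) v) vs"
    by (rule linear_mlext) (simp_all add: alg_mult_add_left alg_mult_smul_left)
  moreover have "alg_mult C u v
      = (\<Sum>w\<in>Mor C. smul (Poly_Mapping.lookup v w) (alg_mult C u (bas w)))" for u
    using assms by (subst free_space_basis_expansion[of "Mor C" v])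
      (simp_all add: category_algebra_def alg_mult_sum_right alg_mult_smul_right)
  ultimately show ?thesis by (simp add: mlext_append)
qed

section \<open>Products as arguments of a multilinear extension\<close>

text \<open>The left side is a linear map \<open>L\<close> applied to the product, with
  \<open>L (bas y) = \<Phi> y\<close>. Bilinearity reduces it to pairs of morphisms, where a
  non-composable pair gives 0. This splits one argument slot into two.\<close>

lemma (in category) sum_lookup_alg_mult:
  fixes \<Phi> :: "'m \<Rightarrow> 'c \<Rightarrow>\<^sub>0 'k::field"
  assumes fin: "finite (Mor C)" and ab: "a \<in> category_algebra C" "b \<in> category_algebra C"
  shows "(\<Sum>y\<in>Mor C. smul (Poly_Mapping.lookup (alg_mult C a b) y) (\<Phi> y))
    = (\<Sum>x\<in>Mor C. smul (Poly_Mapping.lookup a x) (\<Sum>y\<in>Mor C.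
        smul (Poly_Mapping.lookup b y) (if src C x = tgt C y then \<Phi> (cmp C x y) else 0)))"
proof -
  define L where "L = (\<lambda>c. \<Sum>y\<in>Mor C. smul (Poly_Mapping.lookup c y) (\<Phi> y))"
  have add: "L (u + v) = L u + L v" and sm: "L (smul c v) = smul c (L v)" for u v c
    by (simp_all add: L_def lookup_add add_smul sum.distrib lookup_smul smul_sum smul_smul)
  have "L 0 = 0" by (simp add: L_def zero_smul)
  with add have su: "L (sum f A) = (\<Sum>x\<in>A. L (f x))" for f :: "'m \<Rightarrow> 'm \<Rightarrow>\<^sub>0 'k" and A
    by (induction A rule: infinite_finite_induct) simp_all
  have L_bas: "L (bas y) = \<Phi> y" if "y \<in> Mor C" for y
  proof -
    have "L (bas y) = (\<Sum>z\<in>Mor C. if y = z then \<Phi> z else 0)"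
      unfolding L_def by (intro sum.cong) (auto simp: lookup_single when_def one_smul zero_smul)
    then show ?thesis using fin that by simp
  qed
  have right: "alg_mult C u b
      = (\<Sum>y\<in>Mor C. smul (Poly_Mapping.lookup b y) (alg_mult C u (bas y)))" for u
    using ab(2) fin by (subst free_space_basis_expansion[of "Mor C" b])
      (simp_all add: category_algebra_def alg_mult_sum_right alg_mult_smul_right)
  have left: "alg_mult C a b
      = (\<Sum>x\<in>Mor C. smul (Poly_Mapping.lookup a x) (alg_mult C (bas x) b))"
    using ab(1) fin by (subst free_space_basis_expansion[of "Mor C" a])
      (simp_all add: category_algebra_def alg_mult_sum_left alg_mult_smul_left)
  have "alg_mult C a b = (\<Sum>x\<in>Mor C. smul (Poly_Mapping.lookup a x) (\<Sum>y\<in>Mor C.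
      smul (Poly_Mapping.lookup b y) (alg_mult C (bas x) (bas y))))"
    by (simp only: left right[of "bas _"])
  then have "L (alg_mult C a b) = (\<Sum>x\<in>Mor C. smul (Poly_Mapping.lookup a x) (\<Sum>y\<in>Mor C.
      smul (Poly_Mapping.lookup b y) (L (alg_mult C (bas x) (bas y)))))"
    by (simp add: su sm)
  also have "\<dots> = (\<Sum>x\<in>Mor C. smul (Poly_Mapping.lookup a x) (\<Sum>y\<in>Mor C.
        smul (Poly_Mapping.lookup b y) (if src C x = tgt C y then \<Phi> (cmp C x y) else 0)))"
    using cmp_Mor \<open>L 0 = 0\<close> by (intro sum.cong refl arg_cong2[where f = smul])
      (simp add: alg_mult_bas L_bas)
  finally show ?thesis by (simp add: L_def)
qed

text \<open>The prefix \<open>us\<close> is passed by \<open>mlext_append\<close> and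
  \<open>mlext_cong\<close>; at the slot after it, \<open>sum_lookup_alg_mult\<close> replaces the
  product by two neighbouring slots.\<close>

lemma (in category) mlext_alg_mult_middle:
  fixes h :: "'m list \<Rightarrow> 'c \<Rightarrow>\<^sub>0 'k::field"
  assumes fin: "finite (Mor C)" and ab: "a \<in> category_algebra C" "b \<in> category_algebra C"
    and p: "length us = p"
  shows "mlext C h (us @ [alg_mult C a b] @ vs)
    = mlext C (\<lambda>ws. if src C (ws ! p) = tgt C (ws ! Suc p)
        then h (take p ws @ [cmp C (ws ! p) (ws ! Suc p)] @ drop (p + 2) ws) else 0)
      (us @ [a, b] @ vs)"
  (is "_ = mlext C ?G _")
  unfolding mlext_append
proof (rule mlext_cong)
  fix u :: "'m list" assume "length u = length us"
  then have G: "?G (u @ [x, y] @ z) = (if src C x = tgt C y then h (u @ [cmp C x y] @ z) else 0)"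
    for x y z
    using p by (simp add: nth_append)
  have "mlext C (\<lambda>z. ?G (u @ [x, y] @ z)) vs
      = (if src C x = tgt C y then mlext C (\<lambda>z. h (u @ [cmp C x y] @ z)) vs else 0)" for x y
    unfolding G by (simp add: mlext_zero)
  then show "mlext C (\<lambda>c. mlext C (\<lambda>z. h (u @ c @ z)) vs) [alg_mult C a b]
    = mlext C (\<lambda>c. mlext C (\<lambda>z. ?G (u @ c @ z)) vs) [a, b]"
    by (simp only: mlext.simps sum_lookup_alg_mult[OF fin ab])
qed

section \<open>The comparison map as a multilinear extension\<close>

lemma words_Suc: "{ws. length ws = Suc n \<and> set ws \<subseteq> S}
    = (\<lambda>(w, ws). w # ws) ` (S \<times> {ws. length ws = n \<and> set ws \<subseteq> S})"
  by (auto simp: length_Suc_conv image_iff)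

text \<open>By induction on the arguments: a nonempty word is a pair of head and tail, so the
  iterated sums combine into one and the coefficients into one product.\<close>

lemma mlext_eq_sum_words:
  fixes C :: "('o, 'm) cat"
  assumes "finite (Mor C)"
  shows "mlext C h vs = (\<Sum>ws | length ws = length vs \<and> set ws \<subseteq> Mor C.
    smul (\<Prod>i<length vs. Poly_Mapping.lookup (vs ! i) (ws ! i)) (h ws))"
proof (induction vs arbitrary: h)
  case Nil
  have "{ws :: 'm list. length ws = length [] \<and> set ws \<subseteq> Mor C} = {[]}" by auto
  then show ?case by (simp add: one_smul)
next
  case (Cons v vs)
  have inj: "inj_on (\<lambda>(w, ws). w # ws) (Mor C \<times> {ws. length ws = length vs \<and> set ws \<subseteq> Mor C})"
    by (auto simp: inj_on_def)
  have "mlext C h (v # vs) = (\<Sum>w\<in>Mor C. \<Sum>ws | length ws = length vs \<and> set ws \<subseteq> Mor C.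
      smul (\<Prod>i<Suc (length vs). Poly_Mapping.lookup ((v # vs) ! i) ((w # ws) ! i)) (h (w # ws)))"
    by (simp add: Cons smul_sum smul_smul prod.lessThan_Suc_shift del: prod.lessThan_Suc)
  then show ?case
    by (simp only: length_Cons words_Suc sum.reindex[OF inj] sum.cartesian_product)
      (simp add: comp_def case_prod_unfold del: prod.lessThan_Suc)
qed

lemma chi_eq_mlext:
  assumes "finite (Mor C)" "vs \<in> alg_tuples C m"
  shows "chi C m T vs = mlext C (chi_basis C T) vs"
  using assms by (auto simp: chi_def mlext_eq_sum_words alg_tuples_def)

text \<open>In terms of the paper's index, \<open>p = j - 1\<close>.\<close>

definition word_coboundary ::
    "('o, 'm) cat \<Rightarrow> nat \<Rightarrow> ('m list \<Rightarrow> 'm \<Rightarrow>\<^sub>0 'k::field) \<Rightarrow> 'm list \<Rightarrow> 'm \<Rightarrow>\<^sub>0 'k"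
  where "word_coboundary C m h ws =
    alg_mult C (bas (hd ws)) (h (tl ws))
    + (\<Sum>p<m. smul ((- 1) ^ Suc p)
        (if src C (ws ! p) = tgt C (ws ! Suc p)
         then h (take p ws @ [cmp C (ws ! p) (ws ! Suc p)] @ drop (p + 2) ws) else 0))
    + smul ((- 1) ^ Suc m) (alg_mult C (h (butlast ws)) (bas (last ws)))"

text \<open>Each summand of the coboundary is again a multilinear extension: the outer ones by
  absorbing an end factor, the inner ones by splitting a product slot. Agreement of \<open>f\<close>
  with \<open>mlext C h\<close> is asked only on \<open>alg_tuples\<close>, since \<open>chi\<close>
  is \<open>undefined\<close> elsewhere.\<close>

lemma (in category) hochschild_coboundary_mlext:
  assumes fin: "finite (Mor C)" and vs: "vs \<in> alg_tuples C (Suc m)"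
    and f: "\<And>us. us \<in> alg_tuples C m \<Longrightarrow> f us = mlext C h us"
  shows "hochschild_coboundary C m f vs = mlext C (word_coboundary C m h) vs"
proof -
  have l: "length vs = Suc m" and A: "set vs \<subseteq> category_algebra C"
    using vs by (auto simp: alg_tuples_def)
  then have ne: "vs \<noteq> []" by auto
  have left: "alg_mult C (hd vs) (f (tl vs))
      = mlext C (\<lambda>ws. alg_mult C (bas (hd ws)) (h (tl ws))) vs"
  proof (cases vs)
    case (Cons v us)
    then have "us \<in> alg_tuples C m" "v \<in> category_algebra C"
      using l A by (auto simp: alg_tuples_def)
    then show ?thesis using Cons by (simp add: f alg_mult_mlext[OF fin] del: mlext.simps)
  qed (use ne in simp)
  have right: "alg_mult C (f (butlast vs)) (last vs)
      = mlext C (\<lambda>ws. alg_mult C (h (butlast ws)) (bas (last ws))) vs"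
  proof (cases vs rule: rev_cases)
    case (snoc us v)
    then have "us \<in> alg_tuples C m" "v \<in> category_algebra C"
      using l A by (auto simp: alg_tuples_def)
    then show ?thesis using snoc by (simp add: f mlext_alg_mult[OF fin])
  qed (use ne in simp)
  have mid: "f (take p vs @ [alg_mult C (vs ! p) (vs ! Suc p)] @ drop (p + 2) vs)
      = mlext C (\<lambda>ws. if src C (ws ! p) = tgt C (ws ! Suc p)
        then h (take p ws @ [cmp C (ws ! p) (ws ! Suc p)] @ drop (p + 2) ws) else 0) vs"
    if "p < m" for p
  proof -
    have e: "vs = take p vs @ [vs ! p, vs ! Suc p] @ drop (p + 2) vs"
      using that l by (metis Cons_nth_drop_Suc append_Cons append_Nil append_take_drop_id
          Suc_less_eq add_2_eq_Suc' less_Suc_eq)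
    have ab: "vs ! p \<in> category_algebra C" "vs ! Suc p \<in> category_algebra C"
      using A l that by auto
    have "take p vs @ [alg_mult C (vs ! p) (vs ! Suc p)] @ drop (p + 2) vs \<in> alg_tuples C m"
      using l that A ab alg_mult_in set_take_subset[of p vs] set_drop_subset[of "p + 2" vs]
      by (auto simp: alg_tuples_def)
    then show ?thesis
      using mlext_alg_mult_middle[OF fin ab, of "take p vs" p h "drop (p + 2) vs"] e l that
      by (simp add: f)
  qed
  have "(\<Sum>j=1..m. smul ((- 1) ^ j)
        (f (take (j - 1) vs @ [alg_mult C (vs ! (j - 1)) (vs ! j)] @ drop (j + 1) vs)))
    = (\<Sum>p<m. smul ((- 1) ^ Suc p)
        (f (take p vs @ [alg_mult C (vs ! p) (vs ! Suc p)] @ drop (p + 2) vs)))"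
    by (rule sum.reindex_bij_witness[where i = Suc and j = "\<lambda>j. j - 1"]) auto
  also have "\<dots> = mlext C (\<lambda>ws. \<Sum>p<m. smul ((- 1) ^ Suc p)
        (if src C (ws ! p) = tgt C (ws ! Suc p)
         then h (take p ws @ [cmp C (ws ! p) (ws ! Suc p)] @ drop (p + 2) ws) else 0)) vs"
    unfolding mlext_sum mlext_smul using mid by (intro sum.cong refl) simp
  finally show ?thesis
    using vs unfolding hochschild_coboundary_def word_coboundary_def
    by (simp add: mlext_add mlext_smul left right)
qed

section \<open>Composable words and the chains sigma\<close>

lemma composable_iff: "composable C ws \<longleftrightarrow> successively (\<lambda>g f. src C g = tgt C f) ws"
  by (simp add: composable_def successively_conv_nth)

text \<open>Merging keeps the target of \<open>g\<close> and the source of \<open>f\<close>, the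
  only data that the neighbouring letters see.\<close>

lemma composable_cmp:
  assumes "category C" "g \<in> Mor C" "f \<in> Mor C" "src C g = tgt C f"
  shows "composable C (us @ [cmp C g f] @ vs) \<longleftrightarrow> composable C (us @ [g, f] @ vs)"
  using category.cmp_Mor[OF assms] assms(4)
  by (auto simp: composable_iff successively_append_iff successively_Cons)

text \<open>The index set of the sum in \<open>chi_basis\<close>. The empty word has no source, so
  any endomorphism may start it.\<close>

definition start_endos :: "('o, 'm) cat \<Rightarrow> 'm list \<Rightarrow> 'm set"
  where "start_endos C ws = (if ws = [] then endos C else End C (src C (last ws)))"

lemma (in category) endos_tgt_eq: "{a \<in> endos C. tgt C a = x} = End C x"
proof (intro equalityI subsetI CollectI)
  fix a assume "a \<in> {a \<in> endos C. tgt C a = x}"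
  then show "a \<in> End C x" using endosD[of a C] by simp
next
  fix a assume "a \<in> End C x"
  then show "a \<in> endos C \<and> tgt C a = x" using endosI by (simp add: Hom_def)
qed

text \<open>Prefixing a nonempty word leaves its starting endomorphisms unchanged; prefixing the
  empty word selects those at the source of \<open>g\<close>. One filter covers both cases.\<close>

lemma (in category) start_endos_Cons:
  "start_endos C (g # ws) = {a \<in> start_endos C ws. ws = [] \<longrightarrow> tgt C a = src C g}"
  by (simp add: start_endos_def endos_tgt_eq)

lemma (in category) start_endosD:
  "a \<in> start_endos C ws \<Longrightarrow> a \<in> Mor C \<and> src C a = tgt C a \<and> (ws \<noteq> [] \<longrightarrow> tgt C a = src C (last ws))"
  using endosD[of a C] by (auto simp: start_endos_def Hom_def split: if_splits)

text \<open>The claims share one induction, since reassociating at each letter needs the endpoints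
  of the partial composite. The last one moves a right factor past the word to the starting
  morphism.\<close>

lemma (in category) foldr_cmp:
  assumes "composable C ws" "set ws \<subseteq> Mor C" "q \<in> Mor C" "ws \<noteq> [] \<Longrightarrow> src C (last ws) = tgt C q"
  shows "foldr (cmp C) ws q \<in> Mor C"
    and "src C (foldr (cmp C) ws q) = src C q"
    and "tgt C (foldr (cmp C) ws q) = (if ws = [] then tgt C q else tgt C (hd ws))"
    and "\<lbrakk>r \<in> Mor C; src C q = tgt C r\<rbrakk>
      \<Longrightarrow> cmp C (foldr (cmp C) ws q) r = foldr (cmp C) ws (cmp C q r)"
proof -
  have "foldr (cmp C) ws q \<in> Mor C \<and> src C (foldr (cmp C) ws q) = src C q
    \<and> tgt C (foldr (cmp C) ws q) = (if ws = [] then tgt C q else tgt C (hd ws))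
    \<and> (r \<in> Mor C \<and> src C q = tgt C r
      \<longrightarrow> cmp C (foldr (cmp C) ws q) r = foldr (cmp C) ws (cmp C q r))" for r
    using assms
  proof (induction ws)
    case (Cons g ws)
    let ?q = "foldr (cmp C) ws q"
    have g: "g \<in> Mor C" "src C g = tgt C ?q" and
      IH: "?q \<in> Mor C" "src C ?q = src C q" "r \<in> Mor C \<and> src C q = tgt C r
        \<longrightarrow> cmp C ?q r = foldr (cmp C) ws (cmp C q r)"
      using Cons by (auto simp: composable_iff successively_Cons split: if_splits)
    have "cmp C (cmp C g ?q) r = cmp C g (cmp C ?q r)" if "r \<in> Mor C" "src C q = tgt C r"
      using that g IH by (intro cmp_assoc) (auto simp: Hom_def)
    then show ?case using cmp_Mor[OF g(1) IH(1) g(2)] IH by auto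
  qed auto
  then show "foldr (cmp C) ws q \<in> Mor C"
    and "src C (foldr (cmp C) ws q) = src C q"
    and "tgt C (foldr (cmp C) ws q) = (if ws = [] then tgt C q else tgt C (hd ws))"
    and "\<lbrakk>r \<in> Mor C; src C q = tgt C r\<rbrakk>
      \<Longrightarrow> cmp C (foldr (cmp C) ws q) r = foldr (cmp C) ws (cmp C q r)" by blast+
qed

section \<open>Faces of the chain attached to a word\<close>

text \<open>The two conditions behind \<open>sigma_ex1\<close>: determinism gives each next
  endomorphism, cancellation its uniqueness.\<close>

locale right_det_category = category C for C :: "('o, 'm) cat" +
  assumes right_det: "right_deterministic C"
    and right_canc: "right_cancellative C"
begin

abbreviation "Ad \<equiv> adjoint_category C"
abbreviation "arrow \<equiv> (\<lambda>(a, g, b). g)"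

lemma sigma_props:
  assumes "composable C ws" "set ws \<subseteq> Mor C" "a \<in> start_endos C ws"
  shows "sigma C ws a \<in> nerve Ad (length ws)" "hd (fst (sigma C ws a)) = a"
    "map arrow (snd (sigma C ws a)) = rev ws"
  using theI'[OF sigma_ex1[OF right_det right_canc assms[unfolded start_endos_def]]]
  unfolding sigma_def by blast+

text \<open>The recognition principle for the face computations: a chain is determined by its
  initial object and its underlying arrows.\<close>

lemma sigma_eqI:
  assumes "composable C ws" "set ws \<subseteq> Mor C" "a \<in> start_endos C ws"
    and "\<tau> \<in> nerve Ad (length ws)" "hd (fst \<tau>) = a" "map arrow (snd \<tau>) = rev ws"
  shows "sigma C ws a = \<tau>"
  using the1_equality[OF sigma_ex1[OF right_det right_canc assms(1-3)[unfolded start_endos_def]]]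
    assms(4-) unfolding sigma_def by blast

lemma face_in_Ad: "\<lbrakk>\<tau> \<in> nerve Ad (Suc m); i \<le> Suc m\<rbrakk> \<Longrightarrow> face Ad m i \<tau> \<in> nerve Ad m"
  using category.face_in[OF category_adjoint_category] by simp

text \<open>The head \<open>g\<close> of the word is the last arrow of the chain, so the last face
  deletes it and keeps the initial object.\<close>

lemma sigma_face_last:
  assumes "composable C (g # ws)" "set (g # ws) \<subseteq> Mor C" "a \<in> start_endos C (g # ws)"
  shows "face Ad (length ws) (Suc (length ws)) (sigma C (g # ws) a) = sigma C ws a"
proof (rule sigma_eqI[symmetric])
  obtain as gs where s: "sigma C (g # ws) a = (as, gs)" by fastforce
  have P: "(as, gs) \<in> nerve Ad (Suc (length ws))" "hd as = a" "map arrow gs = rev (g # ws)"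
    using sigma_props[OF assms] s by simp_all
  show "composable C ws" "set ws \<subseteq> Mor C" "a \<in> start_endos C ws"
    using assms by (auto simp: composable_iff successively_Cons start_endos_Cons)
  show "face Ad (length ws) (Suc (length ws)) (sigma C (g # ws) a) \<in> nerve Ad (length ws)"
    using P(1) unfolding s by (intro face_in_Ad) auto
  have "as \<noteq> []" using P by (auto simp: nerve_def)
  then show "hd (fst (face Ad (length ws) (Suc (length ws)) (sigma C (g # ws) a))) = a"
    using P s by (cases as) (auto simp: face_def)
  show "map arrow (snd (face Ad (length ws) (Suc (length ws)) (sigma C (g # ws) a))) = rev ws"
    using P s by (simp add: face_def map_butlast)
qed

text \<open>Chains list arrows from the right end of the word, so the object between
  \<open>f\<close> and \<open>g\<close> has index \<open>length vs + 1\<close>. Composing there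
  merges the two letters and keeps the initial object.\<close>

lemma sigma_face_middle:
  assumes ws: "ws = us @ [g, f] @ vs" and "composable C ws" "set ws \<subseteq> Mor C" "a \<in> start_endos C ws"
    and m: "length ws = Suc m"
  shows "face Ad m (Suc (length vs)) (sigma C ws a) = sigma C (us @ [cmp C g f] @ vs) a"
proof (rule sigma_eqI[symmetric])
  let ?i = "Suc (length vs)" and ?w = "us @ [cmp C g f] @ vs"
  obtain as gs where s: "sigma C ws a = (as, gs)" by fastforce
  have P: "(as, gs) \<in> nerve Ad (Suc m)" "hd as = a" "map arrow gs = rev vs @ [f, g] @ rev us"
    using sigma_props[OF assms(2-4)] s ws m by simp_all
  have gf: "g \<in> Mor C" "f \<in> Mor C" "src C g = tgt C f"
    using assms by (auto simp: composable_iff successively_append_iff successively_Cons)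
  have i: "?i \<le> m" "length ?w = m" using ws m by auto
  show "composable C ?w" using composable_cmp[OF category_axioms gf] assms by blast
  show "set ?w \<subseteq> Mor C" using assms cmp_Mor[OF gf] by auto
  show "a \<in> start_endos C ?w"
    using assms cmp_Mor[OF gf] by (auto simp: start_endos_def)
  show "face Ad m ?i (sigma C ws a) \<in> nerve Ad (length ?w)"
    using P(1) i unfolding s by (auto intro: face_in_Ad)
  have "as \<noteq> []" using P by (auto simp: nerve_def)
  then show "hd (fst (face Ad m ?i (sigma C ws a))) = a"
    using P s by (cases as) (auto simp: face_def)
  have l: "length gs = Suc m" using P by (simp add: nerve_def)
  have "arrow (gs ! ?i) = g" "arrow (gs ! length vs) = f"
    using arg_cong[OF P(3), of "\<lambda>l. l ! ?i"] arg_cong[OF P(3), of "\<lambda>l. l ! length vs"] l i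
    by (simp_all add: nth_append)
  then have "arrow (cmp Ad (gs ! ?i) (gs ! length vs)) = cmp C g f"
    by (auto simp: adjoint_category_def split: prod.splits)
  then show "map arrow (snd (face Ad m ?i (sigma C ws a))) = rev ?w"
    using P s i by (simp add: face_def take_map[symmetric] drop_map[symmetric])
qed

text \<open>Dropping \<open>a\<close> makes the second object the initial one. It satisfies the
  equation assumed of \<open>b\<close>, so the two agree by right cancellation.\<close>

lemma sigma_face_0:
  assumes "composable C (ws @ [f])" "set (ws @ [f]) \<subseteq> Mor C" "a \<in> End C (src C f)"
    and b: "b \<in> End C (tgt C f)" "cmp C f a = cmp C b f"
  shows "face Ad (length ws) 0 (sigma C (ws @ [f]) a) = sigma C ws b"
proof (rule sigma_eqI[symmetric])
  obtain as gs where s: "sigma C (ws @ [f]) a = (as, gs)" by fastforce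
  have "a \<in> start_endos C (ws @ [f])" using assms by (simp add: start_endos_def)
  from sigma_props[OF assms(1,2) this] s
  have P: "(as, gs) \<in> nerve Ad (Suc (length ws))" "hd as = a" "map arrow gs = f # rev ws"
    by simp_all
  show "composable C ws" "set ws \<subseteq> Mor C" "b \<in> start_endos C ws"
    using assms endosI
    by (auto simp: composable_iff successively_append_iff successively_Cons start_endos_def)
  show "face Ad (length ws) 0 (sigma C (ws @ [f]) a) \<in> nerve Ad (length ws)"
    using P(1) unfolding s by (intro face_in_Ad) auto
  obtain b' as' where as: "as = a # b' # as'"
    using P by (auto simp: nerve_def length_Suc_conv)
  obtain p gs' where gs: "gs = p # gs'" "arrow p = f" using P(3) by auto
  have "p \<in> Hom Ad a b'" using P(1) as gs by (auto simp: nerve_def)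
  then have "b' \<in> endos C" "f \<in> Hom C (src C a) (src C b')" "cmp C f a = cmp C b' f"
    using gs by (auto simp: adjoint_category_def Hom_def)
  then have "b' \<in> End C (tgt C f)" "cmp C b' f = cmp C b f"
    using endosD[of b' C] b by (auto simp: Hom_def)
  moreover have "f \<in> Hom C (src C f) (tgt C f)" "src C f \<in> Ob C" "tgt C f \<in> Ob C"
    using assms src_in tgt_in by (auto simp: Hom_def)
  ultimately have "b' = b" using right_canc b unfolding right_cancellative_def by blast
  then show "hd (fst (face Ad (length ws) 0 (sigma C (ws @ [f]) a))) = b"
    using s as by (simp add: face_def)
  show "map arrow (snd (face Ad (length ws) 0 (sigma C (ws @ [f]) a))) = rev ws"
    using P s by (simp add: face_def map_tl)
qed

end

section \<open>The comparison maps on words\<close>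

locale finite_det_category = right_det_category C for C :: "('o, 'm) cat" +
  assumes finite_Mor: "finite (Mor C)"
    and left_det: "left_deterministic C"
    and left_canc: "left_cancellative C"
begin

section \<open>Transport of endomorphisms along a morphism\<close>

text \<open>The passage from \<open>a\<^sub>0\<close> to \<open>a\<^sub>1\<close> along an arrow.
  Right determinism and right cancellation justify the description for endomorphisms of the source
  of \<open>f\<close>.\<close>

definition push :: "'m \<Rightarrow> 'm \<Rightarrow> 'm"
  where "push f a = (THE b. b \<in> End C (tgt C f) \<and> cmp C f a = cmp C b f)"

lemma push:
  assumes "f \<in> Mor C" "a \<in> End C (src C f)"
  shows "push f a \<in> End C (tgt C f)" "cmp C f a = cmp C (push f a) f"
proof -
  have f: "f \<in> Hom C (src C f) (tgt C f)" "src C f \<in> Ob C" "tgt C f \<in> Ob C"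
    using assms src_in tgt_in by (auto simp: Hom_def)
  obtain b where b: "b \<in> End C (tgt C f)" "cmp C f a = cmp C b f"
    using right_det f assms unfolding right_deterministic_def by blast
  have "b' = b" if "b' \<in> End C (tgt C f)" "cmp C f a = cmp C b' f" for b'
    using right_canc f b that unfolding right_cancellative_def by metis
  with b have "push f a = b"
    unfolding push_def by blast
  with b show "push f a \<in> End C (tgt C f)" "cmp C f a = cmp C (push f a) f" by auto
qed

text \<open>Left cancellation gives injectivity. For surjectivity, left determinism supplies a
  candidate \<open>a\<close>, and right cancellation identifies its image with the given
  \<open>b\<close>.\<close>

lemma bij_betw_push:
  assumes "f \<in> Mor C"
  shows "bij_betw (push f) (End C (src C f)) (End C (tgt C f))"
proof (rule bij_betw_imageI)
  have f: "f \<in> Hom C (src C f) (tgt C f)" "src C f \<in> Ob C" "tgt C f \<in> Ob C"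
    using assms src_in tgt_in by (auto simp: Hom_def)
  have "a = a'" if "a \<in> End C (src C f)" "a' \<in> End C (src C f)" "push f a = push f a'" for a a'
  proof -
    have "cmp C f a = cmp C f a'" using push(2)[OF assms] that by metis
    then show ?thesis using left_canc f that unfolding left_cancellative_def by blast
  qed
  then show "inj_on (push f) (End C (src C f))" by (auto intro: inj_onI)
  show "push f ` End C (src C f) = End C (tgt C f)"
  proof safe
    fix b assume b: "b \<in> End C (tgt C f)"
    then obtain a where a: "a \<in> End C (src C f)" "cmp C f a = cmp C b f"
      using left_det f unfolding left_deterministic_def by blast
    have "push f a = b"
      using push[OF assms a(1)] a b f right_canc unfolding right_cancellative_def by metis
    then show "b \<in> push f ` End C (src C f)" using a by blast
  qed (use push[OF assms] in blast)
qed

section \<open>Hochschild terms of the comparison values\<close>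

lemma finite_start_endos: "finite (start_endos C ws)"
  using finite_Mor start_endosD by (auto intro: finite_subset)

lemma chi_basis_alt: "chi_basis C T ws = (if composable C ws
  then \<Sum>a\<in>start_endos C ws. smul (T (bas (sigma C ws a))) (bas (foldr (cmp C) ws a)) else 0)"
  by (simp add: chi_basis_def start_endos_def)

text \<open>Left multiplication changes neither the starting endomorphism nor
  \<open>sigma C ws a\<close>. For nonempty \<open>ws\<close> the composability test does not depend
  on \<open>a\<close>; for empty \<open>ws\<close> it restricts the sum to endomorphisms at the
  source of \<open>g\<close>.\<close>

lemma alg_mult_chi_basis:
  assumes g: "g \<in> Mor C" and ws: "set ws \<subseteq> Mor C"
  shows "alg_mult C (bas g) (chi_basis C T ws) = (if composable C (g # ws)
    then \<Sum>a\<in>start_endos C (g # ws).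
      smul (T (bas (sigma C ws a))) (bas (foldr (cmp C) (g # ws) a)) else 0)"
proof (cases "composable C ws")
  case True
  have t: "tgt C (foldr (cmp C) ws a) = (if ws = [] then tgt C a else tgt C (hd ws))"
    if "a \<in> start_endos C ws" for a
    using foldr_cmp(3)[OF True ws, of a] start_endosD[OF that] by auto
  have "alg_mult C (bas g) (chi_basis C T ws) = (\<Sum>a\<in>start_endos C ws.
      if src C g = (if ws = [] then tgt C a else tgt C (hd ws))
      then smul (T (bas (sigma C ws a))) (bas (foldr (cmp C) (g # ws) a)) else 0)"
    using True t by (simp add: chi_basis_alt alg_mult_sum_right alg_mult_smul_right alg_mult_bas
        if_distrib[of "smul _"] smul_zero cong: if_cong)
  also have "\<dots> = (if composable C (g # ws) then \<Sum>a\<in>start_endos C (g # ws).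
      smul (T (bas (sigma C ws a))) (bas (foldr (cmp C) (g # ws) a)) else 0)"
  proof (cases "ws = []")
    case nil: True
    then show ?thesis unfolding start_endos_Cons using finite_start_endos
      by (subst sum.inter_filter) (auto simp: composable_iff intro!: sum.cong)
  next
    case False
    then show ?thesis using True by (simp add: composable_iff successively_Cons start_endos_Cons)
  qed
  finally show ?thesis .
next
  case False
  then show ?thesis by (auto simp: chi_basis_alt alg_mult_zero_right composable_iff successively_Cons)
qed

text \<open>Right multiplication by \<open>f\<close> leaves a sum over endomorphisms
  \<open>b\<close> of the target of \<open>f\<close>. Substituting \<open>b = push f a\<close> turns
  \<open>cmp C b f\<close> into \<open>cmp C f a\<close>, so the composite becomes that of the
  longer word.\<close>

lemma chi_basis_alg_mult:
  assumes f: "f \<in> Mor C" and ws: "set ws \<subseteq> Mor C"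
  shows "alg_mult C (chi_basis C T ws) (bas f) = (if composable C (ws @ [f])
    then \<Sum>a\<in>start_endos C (ws @ [f]).
      smul (T (bas (sigma C ws (push f a)))) (bas (foldr (cmp C) (ws @ [f]) a)) else 0)"
proof (cases "composable C ws")
  case True
  have s: "src C (foldr (cmp C) ws a) = tgt C a" if "a \<in> start_endos C ws" for a
    using foldr_cmp(2)[OF True ws, of a] start_endosD[OF that] by metis
  \<comment> \<open>For nonempty \<open>ws\<close> all starting endomorphisms share one target, so
    the filter keeps all or none; for empty \<open>ws\<close> it picks out the endomorphisms of the
    target of \<open>f\<close>.\<close>
  have e: "{a \<in> start_endos C ws. tgt C a = tgt C f}
      = (if composable C (ws @ [f]) then End C (tgt C f) else {})"
  proof (cases "ws = []")
    case True
    then show ?thesis by (simp add: start_endos_def composable_iff endos_tgt_eq)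
  next
    case False
    then show ?thesis using \<open>composable C ws\<close>
      by (force simp: start_endos_def composable_iff successively_append_iff Hom_def)
  qed
  have "alg_mult C (chi_basis C T ws) (bas f) = (\<Sum>a\<in>start_endos C ws. if tgt C a = tgt C f
      then smul (T (bas (sigma C ws a))) (bas (cmp C (foldr (cmp C) ws a) f)) else 0)"
    using True s by (simp add: chi_basis_alt alg_mult_sum_left alg_mult_smul_left alg_mult_bas
        if_distrib[of "smul _"] smul_zero cong: if_cong)
  also have "\<dots> = (\<Sum>a | a \<in> start_endos C ws \<and> tgt C a = tgt C f.
      smul (T (bas (sigma C ws a))) (bas (cmp C (foldr (cmp C) ws a) f)))"
    using finite_start_endos by (subst sum.inter_filter) auto
  also have "\<dots> = (if composable C (ws @ [f]) then \<Sum>b\<in>End C (tgt C f).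
      smul (T (bas (sigma C ws b))) (bas (cmp C (foldr (cmp C) ws b) f)) else 0)"
    unfolding e by simp
  also have "\<dots> = (if composable C (ws @ [f]) then \<Sum>a\<in>End C (src C f).
      smul (T (bas (sigma C ws (push f a)))) (bas (cmp C (foldr (cmp C) ws (push f a)) f)) else 0)"
    using sum.reindex_bij_betw[OF bij_betw_push[OF f],
        of "\<lambda>b. smul (T (bas (sigma C ws b))) (bas (cmp C (foldr (cmp C) ws b) f))"] by simp
  also have "\<dots> = (if composable C (ws @ [f]) then \<Sum>a\<in>End C (src C f).
      smul (T (bas (sigma C ws (push f a)))) (bas (foldr (cmp C) (ws @ [f]) a)) else 0)"
  proof (intro if_cong refl sum.cong arg_cong2[where f = smul])
    fix a assume c: "composable C (ws @ [f])" and a: "a \<in> End C (src C f)"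
    have "cmp C (foldr (cmp C) ws (push f a)) f = foldr (cmp C) ws (cmp C (push f a) f)"
      using c ws f push[OF f a] True
      by (intro foldr_cmp(4)) (auto simp: Hom_def composable_iff successively_append_iff)
    then show "bas (cmp C (foldr (cmp C) ws (push f a)) f) = bas (foldr (cmp C) (ws @ [f]) a)"
      using push[OF f a] by simp
  qed
  finally show ?thesis by (simp add: start_endos_def)
next
  case False
  then show ?thesis
    by (auto simp: chi_basis_alt alg_mult_zero_left composable_iff successively_append_iff)
qed

text \<open>Only one reassociation is involved, at \<open>g\<close>, \<open>f\<close> and the
  composite of \<open>vs\<close> with \<open>a\<close>.\<close>

lemma foldr_cmp_merge:
  assumes "composable C (us @ [g, f] @ vs)" "set (us @ [g, f] @ vs) \<subseteq> Mor C"
    "a \<in> start_endos C (us @ [g, f] @ vs)"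
  shows "foldr (cmp C) (us @ [cmp C g f] @ vs) a = foldr (cmp C) (us @ [g, f] @ vs) a"
proof -
  let ?q = "foldr (cmp C) vs a"
  have "composable C vs" "set vs \<subseteq> Mor C" "vs \<noteq> [] \<longrightarrow> src C (last vs) = tgt C a" "a \<in> Mor C"
    using assms start_endosD[OF assms(3)]
    by (auto simp: composable_iff successively_append_iff successively_Cons)
  with foldr_cmp[of vs a] have "?q \<in> Mor C" "tgt C ?q = (if vs = [] then tgt C a else tgt C (hd vs))"
    by auto
  moreover have "src C f = (if vs = [] then tgt C a else tgt C (hd vs))" "src C g = tgt C f"
    using assms start_endosD[OF assms(3)]
    by (auto simp: composable_iff successively_append_iff successively_Cons)
  ultimately have "cmp C (cmp C g f) ?q = cmp C g (cmp C f ?q)"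
    using assms(2) by (intro cmp_assoc) (auto simp: Hom_def)
  then show ?thesis by simp
qed

text \<open>Merging preserves composability, starting endomorphisms and the total composite, while
  the chain turns into an inner face. If \<open>g\<close> and \<open>f\<close> do not compose, both
  sides vanish.\<close>

lemma chi_basis_merge:
  assumes "set (us @ [g, f] @ vs) \<subseteq> Mor C" and m: "length (us @ [g, f] @ vs) = Suc m"
  shows "(if src C g = tgt C f then chi_basis C T (us @ [cmp C g f] @ vs) else 0)
    = (if composable C (us @ [g, f] @ vs) then \<Sum>a\<in>start_endos C (us @ [g, f] @ vs).
        smul (T (bas (face Ad m (Suc (length vs)) (sigma C (us @ [g, f] @ vs) a))))
          (bas (foldr (cmp C) (us @ [g, f] @ vs) a)) else 0)"
proof (cases "src C g = tgt C f")
  case True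
  have gf: "g \<in> Mor C" "f \<in> Mor C" using assms by auto
  have "start_endos C (us @ [cmp C g f] @ vs) = start_endos C (us @ [g, f] @ vs)"
    using cmp_Mor[OF gf True] by (simp add: start_endos_def)
  moreover note composable_cmp[OF category_axioms gf True, of us vs]
  moreover have "(\<Sum>a\<in>start_endos C (us @ [g, f] @ vs).
        smul (T (bas (sigma C (us @ [cmp C g f] @ vs) a))) (bas (foldr (cmp C) (us @ [cmp C g f] @ vs) a)))
    = (\<Sum>a\<in>start_endos C (us @ [g, f] @ vs).
        smul (T (bas (face Ad m (Suc (length vs)) (sigma C (us @ [g, f] @ vs) a))))
          (bas (foldr (cmp C) (us @ [g, f] @ vs) a)))"
    if c: "composable C (us @ [g, f] @ vs)"
    using sigma_face_middle[OF refl c assms(1) _ m] foldr_cmp_merge[OF c assms(1)]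
    by (intro sum.cong refl) metis
  ultimately show ?thesis using True by (simp only: chi_basis_alt simp_thms if_True cong: if_cong)
next
  case False
  then show ?thesis by (auto simp: composable_iff successively_append_iff)
qed

lemma free_map_bas: "free_map d (bas x) = bas (d x)"
  by (simp add: free_map_def)

section \<open>The coboundary identity on words\<close>

text \<open>Both sides are signed sums of the same face contributions \<open>F i\<close>; it remains
  to match Hochschild terms with faces and compare signs. Non-composable words are included because
  every \<open>F i\<close> is then 0.\<close>

lemma chi_basis_coboundary:
  fixes T :: "(('m, 'm \<times> 'm \<times> 'm) chain \<Rightarrow>\<^sub>0 'k::field) \<Rightarrow> 'k"
  assumes l: "length ws = Suc m" and ws: "set ws \<subseteq> Mor C"
  shows "chi_basis C (simplicial_coboundary Ad m T) ws
    = smul ((- 1) ^ Suc m) (word_coboundary C m (chi_basis C T) ws)"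
proof -
  \<comment> \<open>The contribution of the face with index \<open>i\<close>, without its
    sign.\<close>
  define F where "F i = (if composable C ws then \<Sum>a\<in>start_endos C ws.
      smul (T (bas (face Ad m i (sigma C ws a)))) (bas (foldr (cmp C) ws a)) else 0)" for i
  have coboundary: "simplicial_coboundary Ad m T (bas (sigma C ws a))
      = (\<Sum>i=0..Suc m. (- 1) ^ i * T (bas (face Ad m i (sigma C ws a))))"
    if "composable C ws" "a \<in> start_endos C ws" for a
    using sigma_props(1)[OF that(1) ws that(2)] l
    by (simp add: simplicial_coboundary_def free_space_single free_map_bas)
  have "chi_basis C (simplicial_coboundary Ad m T) ws = (\<Sum>i=0..Suc m. smul ((- 1) ^ i) (F i))"
  proof (cases "composable C ws")
    case True
    then have "chi_basis C (simplicial_coboundary Ad m T) ws = (\<Sum>a\<in>start_endos C ws.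
        \<Sum>i=0..Suc m. smul ((- 1) ^ i * T (bas (face Ad m i (sigma C ws a))))
          (bas (foldr (cmp C) ws a)))"
      by (simp only: chi_basis_alt coboundary sum_smul if_True cong: sum.cong)
    also have "\<dots> = (\<Sum>i=0..Suc m. smul ((- 1) ^ i) (F i))"
      using True by (subst sum.swap) (simp add: F_def smul_sum smul_smul)
    finally show ?thesis .
  qed (simp add: chi_basis_alt F_def smul_zero)
  also have "\<dots> = F 0 + (\<Sum>i=1..m. smul ((- 1) ^ i) (F i)) + smul ((- 1) ^ Suc m) (F (Suc m))"
    by (simp add: sum.atLeast_Suc_atMost one_smul add.assoc)
  \<comment> \<open>Letters are counted from the left, chain objects from the other end: merging at
    letter \<open>p\<close> is the face with index \<open>m - p\<close>.\<close>
  also have "(\<Sum>i=1..m. smul ((- 1) ^ i) (F i)) = (\<Sum>p<m. smul ((- 1) ^ (m - p)) (F (m - p)))"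
    by (rule sum.reindex_bij_witness[where i = "\<lambda>p. m - p" and j = "\<lambda>i. m - i"]) auto
  finally have lhs: "chi_basis C (simplicial_coboundary Ad m T) ws
    = F 0 + (\<Sum>p<m. smul ((- 1) ^ (m - p)) (F (m - p))) + smul ((- 1) ^ Suc m) (F (Suc m))" .

  have left: "alg_mult C (bas (hd ws)) (chi_basis C T (tl ws)) = F (Suc m)"
  proof (cases ws)
    case (Cons g us)
    then have m: "m = length us" using l by simp
    show ?thesis using ws sigma_face_last[of g us]
      unfolding F_def m Cons list.sel
      by (subst alg_mult_chi_basis) (auto intro!: sum.cong simp del: foldr.simps)
  qed (use l in simp)
  have right: "alg_mult C (chi_basis C T (butlast ws)) (bas (last ws)) = F 0"
  proof (cases ws rule: rev_cases)
    case (snoc us f)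
    then have m: "m = length us" and f: "f \<in> Mor C" and us: "set us \<subseteq> Mor C" using l ws by auto
    have "face Ad m 0 (sigma C (us @ [f]) a) = sigma C us (push f a)"
      if "composable C (us @ [f])" "a \<in> start_endos C (us @ [f])" for a
      using that ws push[OF f, of a] unfolding m snoc
      by (intro sigma_face_0) (auto simp: start_endos_def)
    then show ?thesis using chi_basis_alg_mult[OF f us, of T] snoc by (simp add: F_def)
  qed (use l in simp)
  have middle: "(if src C (ws ! p) = tgt C (ws ! Suc p)
      then chi_basis C T (take p ws @ [cmp C (ws ! p) (ws ! Suc p)] @ drop (p + 2) ws) else 0)
      = F (m - p)" if "p < m" for p
  proof -
    have e: "ws = take p ws @ [ws ! p, ws ! Suc p] @ drop (p + 2) ws"
      using that l by (metis Cons_nth_drop_Suc append_Cons append_Nil append_take_drop_id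
          Suc_less_eq add_2_eq_Suc' less_Suc_eq)
    have "Suc (length (drop (p + 2) ws)) = m - p" using that l by simp
    then show ?thesis
      using chi_basis_merge[of "take p ws" "ws ! p" "ws ! Suc p" "drop (p + 2) ws" m T] l ws
      unfolding F_def e[symmetric] by simp
  qed
  \<comment> \<open>The exponents \<open>m - p\<close> and \<open>(m + 1) + (p + 1)\<close> differ
    by the even number \<open>2 * (p + 1)\<close>.\<close>
  have sign: "(- 1) ^ Suc m * (- 1) ^ Suc p = ((- 1) ^ (m - p) :: 'k)" if "p < m" for p
  proof -
    have "Suc m + Suc p = (m - p) + 2 * Suc p" using that by simp
    then have "(- 1) ^ Suc m * (- 1) ^ Suc p = (- 1 :: 'k) ^ ((m - p) + 2 * Suc p)"
      by (simp only: power_add[symmetric])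
    also have "\<dots> = (- 1) ^ (m - p)" by (simp only: power_add power_mult) simp
    finally show ?thesis .
  qed
  have "(\<Sum>p<m. smul ((- 1) ^ (m - p)) (F (m - p)))
    = smul ((- 1) ^ Suc m) (\<Sum>p<m. smul ((- 1) ^ Suc p)
        (if src C (ws ! p) = tgt C (ws ! Suc p)
         then chi_basis C T (take p ws @ [cmp C (ws ! p) (ws ! Suc p)] @ drop (p + 2) ws) else 0))"
    unfolding smul_sum smul_smul by (intro sum.cong refl) (simp only: lessThan_iff sign middle)
  \<comment> \<open>On the Hochschild side \<open>F 0\<close> carries the factor
    \<open>(-1)^(m+1)\<close> twice, once from the last term and once from the overall sign; they
    cancel.\<close>
  moreover have "F 0 = smul ((- 1) ^ Suc m) (smul ((- 1) ^ Suc m) (F 0))"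
    unfolding smul_smul power_mult_distrib[symmetric] by (simp add: one_smul)
  ultimately show ?thesis
    unfolding lhs word_coboundary_def left right smul_add by (simp only: ac_simps)
qed

end

section \<open>Extension from words to all tensors\<close>

theorem proposition8:
  fixes C :: "('o, 'm) cat" and m :: nat
    and T :: "(('m, 'm \<times> 'm \<times> 'm) chain \<Rightarrow>\<^sub>0 'k::field) \<Rightarrow> 'k"
  assumes "finite_category C"
    and "deterministic C"
    and "cancellative C"
    and "T \<in> simplicial_cochains (adjoint_category C) m"
  shows "chi C (m + 1) (simplicial_coboundary (adjoint_category C) m T) =
    hochschild_smul C (m + 1) ((- 1) ^ (m + 1)) (hochschild_coboundary C m (chi C m T))"
proof -
  interpret category C using assms(1) by (simp add: finite_category_def)
  \<comment> \<open>Finiteness is given hom set by hom set; since sources and targets are objects,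
    it passes to the set of all morphisms.\<close>
  have "Mor C = (\<Union>x\<in>Ob C. \<Union>y\<in>Ob C. Hom C x y)"
    using src_in tgt_in by (auto simp: Hom_def)
  then have fin: "finite (Mor C)" using assms(1) by (simp add: finite_category_def)
  interpret finite_det_category C
    using assms(2,3) fin
    by unfold_locales (simp_all add: deterministic_def cancellative_def)
  show ?thesis
  proof
    fix vs :: "('m \<Rightarrow>\<^sub>0 'k) list"
    show "chi C (m + 1) (simplicial_coboundary Ad m T) vs
      = hochschild_smul C (m + 1) ((- 1) ^ (m + 1)) (hochschild_coboundary C m (chi C m T)) vs"
    proof (cases "vs \<in> alg_tuples C (Suc m)")
      case True
      then have "chi C (m + 1) (simplicial_coboundary Ad m T) vs
          = mlext C (\<lambda>ws. smul ((- 1) ^ Suc m) (word_coboundary C m (chi_basis C T) ws)) vs"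
        by (subst chi_eq_mlext[OF fin], simp)
          (intro mlext_cong chi_basis_coboundary, auto simp: alg_tuples_def)
      also have "\<dots> = smul ((- 1) ^ Suc m) (hochschild_coboundary C m (chi C m T) vs)"
        using hochschild_coboundary_mlext[OF fin True chi_eq_mlext[OF fin]] by (simp add: mlext_smul)
      finally show ?thesis using True by (simp add: hochschild_smul_def)
    \<comment> \<open>Off \<open>alg_tuples\<close> both functions are
      \<open>undefined\<close>.\<close>
    qed (simp add: chi_def hochschild_smul_def)
  qed
qed

end
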